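(* Let $\mathcal{C}=(\mathcal{C},\mathbb{E},\mathfrak{s},\mathbb{E}^{-1})$ be an extriangulated category with a negative first extension. Let $t_1=(\mathcal{U}_1,\mathcal{V}_1)$ and $t_2=(\mathcal{U}_2,\mathcal{V}_2)$ be two torsion pairs in $\mathcal{C}$ with $t_1\preccurlyeq t_2$, and let $\mathcal{H}_{[t_1,t_2]}=\mathcal{U}_2\cap\mathcal{V}_1$. Then there are order preserving (i.e. $\preccurlyeq$-preserving), mutually inverse bijections $\Phi$ and $\Psi$ between (1) the set of torsion pairs (resp. $s$-torsion pairs) $t=(\mathcal{U},\mathcal{V})$ in $\mathcal{C}$ with $t_1\preccurlyeq t\preccurlyeq t_2$, and (2) the set of torsion pairs (resp. $s$-torsion pairs) $(\mathcal{T},\mathcal{F})$ in $\mathcal{H}_{[t_1,t_2]}$ with $\mathbb{E}^{-1}(\mathcal{T},\mathcal{V}_2)=0$ and $\mathbb{E}^{-1}(\mathcal{U}_1,\mathcal{F})=0$, given by $$\Phi(\mathcal{U},\mathcal{V})=(\mathcal{U}\cap\mathcal{V}_1,\ \mathcal{V}\cap\mathcal{U}_2),\qquad \Psi(\mathcal{T},\mathcal{F})=(\mathcal{U}_1*\mathcal{T},\ \mathcal{F}*\mathcal{V}_2).$$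
   Context: All categories are skeletally small; all subcategories are full and closed under isomorphisms. Extriangulated categories are in the sense of Nakaoka–Palu: a triple $(\mathcal{C},\mathbb{E},\mathfrak{s})$ with $\mathcal{C}$ additive, $\mathbb{E}:\mathcal{C}^{\mathrm{op}}\times\mathcal{C}\to Ab$ an additive bifunctor and $\mathfrak{s}$ an additive realization; $\delta\in\mathbb{E}(C,A)$ with $\mathfrak{s}(\delta)=[A\to B\to C]$ is written as an $\mathbb{E}$-triangle $A\to B\to C\dashrightarrow$. A negative first extension structure on $\mathcal{C}$ is an additive bifunctor $\mathbb{E}^{-1}:\mathcal{C}^{\mathrm{op}}\times\mathcal{C}\to Ab$ such that for every $\mathbb{E}$-triangle $A\to B\to C\dashrightarrow$ and every $W\in\mathcal{C}$ there are exact sequences $\mathbb{E}^{-1}(W,A)\to\mathbb{E}^{-1}(W,B)\to\mathbb{E}^{-1}(W,C)\to\mathcal{C}(W,A)\to\mathcal{C}(W,B)$ and $\mathbb{E}^{-1}(C,W)\to\mathbb{E}^{-1}(B,W)\to\mathbb{E}^{-1}(A,W)\to\mathcal{C}(C,W)\to\mathcal{C}(B,W)$. An extension-closed subcategory inherits an extriangulated structure and a negative first extension by restriction. For subcategories $\mathcal{X},\mathcal{Y}$, $\mathcal{X}*\mathcal{Y}$ is the subcategory of objects $A$ admitting an $\mathbb{E}$-triangle $X\to A\to Y\dashrightarrow$ with $X\in\mathcal{X}$, $Y\in\mathcal{Y}$. A torsion pair in $\mathcal{C}$ is a pair $(\mathcal{U},\mathcal{V})$ of additive subcategories closed under direct sums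 and direct summands with $\mathcal{C}(\mathcal{U},\mathcal{V})=0$ and $\mathcal{C}=\mathcal{U}*\mathcal{V}$. It is an $s$-torsion pair if in addition $\mathbb{E}^{-1}(\mathcal{U},\mathcal{V})=0$. For torsion pairs $t_1=(\mathcal{U}_1,\mathcal{V}_1)$, $t_2=(\mathcal{U}_2,\mathcal{V}_2)$ (in $\mathcal C$, or in any extriangulated category with negative first extension), $t_1\preccurlyeq t_2$ means $\mathcal{C}(\mathcal{U}_1,\mathcal{V}_2)=0$ and $\mathbb{E}^{-1}(\mathcal{U}_1,\mathcal{V}_2)=0$. This relation is transitive but not necessarily reflexive. The subcategory $\mathcal{H}_{[t_1,t_2]}$ is extension-closed, hence itself an extriangulated category with a negative first extension by restriction; torsion pairs, $s$-torsion pairs and $\preccurlyeq$ in it are understood in this sense.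
   Formalization: "Closed under direct summands" is read as closed under retracts (A→B→A composing to the identity, no complement required); with complemented summands only, the claim fails in categories that are not weakly idempotent complete. *)

theory Defs
  imports "HOL-Algebra.Coset"
begin

text \<open>
  Conventions.  A category has a set of objects, hom-groups \<open>mor C A B\<close> and a composition
  \<open>g \<cdot>\<^bsub>C\<^esub> f\<close> (first \<open>f\<close>, then \<open>g\<close>).  Abelian groups are the \<open>comm_group\<close>s of HOL-Algebra, so the
  sum of two morphisms is written \<open>\<otimes>\<close> and the zero morphism is written \<open>\<one>\<close>.  Composition and the
  action of a bifunctor on morphisms do not carry the objects as indices; hom-groups at different
  objects may, but need not, be disjoint.
\<close>

record ('o, 'm) category =
  obj :: "'o set"
  mor :: "'o \<Rightarrow> 'o \<Rightarrow> 'm monoid"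
  cmp :: "'m \<Rightarrow> 'm \<Rightarrow> 'm" (infixl "\<cdot>\<index>" 75)
  idn :: "'o \<Rightarrow> 'm"

definition is_biproduct ::
  "('o, 'm, 'z) category_scheme \<Rightarrow> 'o \<Rightarrow> 'o \<Rightarrow> 'o \<Rightarrow> 'm \<Rightarrow> 'm \<Rightarrow> 'm \<Rightarrow> 'm \<Rightarrow> bool" where
  "is_biproduct C A B P i j p q \<longleftrightarrow>
     A \<in> obj C \<and> B \<in> obj C \<and> P \<in> obj C \<and>
     i \<in> carrier (mor C A P) \<and> j \<in> carrier (mor C B P) \<and>
     p \<in> carrier (mor C P A) \<and> q \<in> carrier (mor C P B) \<and>
     p \<cdot>\<^bsub>C\<^esub> i = idn C A \<and> q \<cdot>\<^bsub>C\<^esub> j = idn C B \<and>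
     q \<cdot>\<^bsub>C\<^esub> i = \<one>\<^bsub>mor C A B\<^esub> \<and> p \<cdot>\<^bsub>C\<^esub> j = \<one>\<^bsub>mor C B A\<^esub> \<and>
     (i \<cdot>\<^bsub>C\<^esub> p) \<otimes>\<^bsub>mor C P P\<^esub> (j \<cdot>\<^bsub>C\<^esub> q) = idn C P"

locale additive_category =
  fixes C :: "('o, 'm, 'z) category_scheme"
  assumes mor_group: "\<lbrakk>A \<in> obj C; B \<in> obj C\<rbrakk> \<Longrightarrow> comm_group (mor C A B)"
    and cmp_closed:
      "\<lbrakk>A \<in> obj C; B \<in> obj C; D \<in> obj C; f \<in> carrier (mor C A B); g \<in> carrier (mor C B D)\<rbrakk>
        \<Longrightarrow> g \<cdot>\<^bsub>C\<^esub> f \<in> carrier (mor C A D)"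
    and cmp_assoc:
      "\<lbrakk>A \<in> obj C; B \<in> obj C; D \<in> obj C; E \<in> obj C;
        f \<in> carrier (mor C A B); g \<in> carrier (mor C B D); h \<in> carrier (mor C D E)\<rbrakk>
        \<Longrightarrow> h \<cdot>\<^bsub>C\<^esub> (g \<cdot>\<^bsub>C\<^esub> f) = (h \<cdot>\<^bsub>C\<^esub> g) \<cdot>\<^bsub>C\<^esub> f"
    and idn_closed: "A \<in> obj C \<Longrightarrow> idn C A \<in> carrier (mor C A A)"
    and cmp_idn_right:
      "\<lbrakk>A \<in> obj C; B \<in> obj C; f \<in> carrier (mor C A B)\<rbrakk> \<Longrightarrow> f \<cdot>\<^bsub>C\<^esub> idn C A = f"
    and cmp_idn_left:
      "\<lbrakk>A \<in> obj C; B \<in> obj C; f \<in> carrier (mor C A B)\<rbrakk> \<Longrightarrow> idn C B \<cdot>\<^bsub>C\<^esub> f = f"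
    and cmp_add_right:
      "\<lbrakk>A \<in> obj C; B \<in> obj C; D \<in> obj C;
        f \<in> carrier (mor C A B); f' \<in> carrier (mor C A B); g \<in> carrier (mor C B D)\<rbrakk>
        \<Longrightarrow> g \<cdot>\<^bsub>C\<^esub> (f \<otimes>\<^bsub>mor C A B\<^esub> f') = (g \<cdot>\<^bsub>C\<^esub> f) \<otimes>\<^bsub>mor C A D\<^esub> (g \<cdot>\<^bsub>C\<^esub> f')"
    and cmp_add_left:
      "\<lbrakk>A \<in> obj C; B \<in> obj C; D \<in> obj C;
        f \<in> carrier (mor C A B); g \<in> carrier (mor C B D); g' \<in> carrier (mor C B D)\<rbrakk>
        \<Longrightarrow> (g \<otimes>\<^bsub>mor C B D\<^esub> g') \<cdot>\<^bsub>C\<^esub> f = (g \<cdot>\<^bsub>C\<^esub> f) \<otimes>\<^bsub>mor C A D\<^esub> (g' \<cdot>\<^bsub>C\<^esub> f)"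
    and zero_object: "\<exists>Z\<in>obj C. idn C Z = \<one>\<^bsub>mor C Z Z\<^esub>"
    and biproducts: "\<lbrakk>A \<in> obj C; B \<in> obj C\<rbrakk> \<Longrightarrow> \<exists>P i j p q. is_biproduct C A B P i j p q"

definition is_iso :: "('o, 'm, 'z) category_scheme \<Rightarrow> 'o \<Rightarrow> 'o \<Rightarrow> 'm \<Rightarrow> bool" where
  "is_iso C A B f \<longleftrightarrow> f \<in> carrier (mor C A B) \<and>
     (\<exists>g\<in>carrier (mor C B A). g \<cdot>\<^bsub>C\<^esub> f = idn C A \<and> f \<cdot>\<^bsub>C\<^esub> g = idn C B)"

text \<open>
  \<open>bmap F c a\<close> is the map \<open>F(c, a) : F(C, A) \<rightarrow> F(C', A')\<close> for \<open>c : C' \<rightarrow> C\<close> and \<open>a : A \<rightarrow> A'\<close>: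
  contravariant in the first argument and covariant in the second.
\<close>

record ('o, 'm, 'e) bifunctor =
  bgrp :: "'o \<Rightarrow> 'o \<Rightarrow> 'e monoid"
  bmap :: "'m \<Rightarrow> 'm \<Rightarrow> 'e \<Rightarrow> 'e"

locale additive_bifunctor =
  fixes C :: "('o, 'm, 'z) category_scheme" and F :: "('o, 'm, 'e) bifunctor"
  assumes bgrp_group: "\<lbrakk>X \<in> obj C; A \<in> obj C\<rbrakk> \<Longrightarrow> comm_group (bgrp F X A)"
    and bmap_hom:
      "\<lbrakk>X \<in> obj C; X' \<in> obj C; A \<in> obj C; A' \<in> obj C;
        c \<in> carrier (mor C X' X); a \<in> carrier (mor C A A')\<rbrakk>
        \<Longrightarrow> bmap F c a \<in> hom (bgrp F X A) (bgrp F X' A')"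
    and bmap_idn:
      "\<lbrakk>X \<in> obj C; A \<in> obj C; d \<in> carrier (bgrp F X A)\<rbrakk>
        \<Longrightarrow> bmap F (idn C X) (idn C A) d = d"
    and bmap_cmp:
      "\<lbrakk>X \<in> obj C; X' \<in> obj C; X'' \<in> obj C; A \<in> obj C; A' \<in> obj C; A'' \<in> obj C;
        c \<in> carrier (mor C X' X); c' \<in> carrier (mor C X'' X');
        a \<in> carrier (mor C A A'); a' \<in> carrier (mor C A' A''); d \<in> carrier (bgrp F X A)\<rbrakk>
        \<Longrightarrow> bmap F (c \<cdot>\<^bsub>C\<^esub> c') (a' \<cdot>\<^bsub>C\<^esub> a) d = bmap F c' a' (bmap F c a d)"
    and bmap_add_left:
      "\<lbrakk>X \<in> obj C; X' \<in> obj C; A \<in> obj C; A' \<in> obj C;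
        c \<in> carrier (mor C X' X); c' \<in> carrier (mor C X' X); a \<in> carrier (mor C A A');
        d \<in> carrier (bgrp F X A)\<rbrakk>
        \<Longrightarrow> bmap F (c \<otimes>\<^bsub>mor C X' X\<^esub> c') a d = bmap F c a d \<otimes>\<^bsub>bgrp F X' A'\<^esub> bmap F c' a d"
    and bmap_add_right:
      "\<lbrakk>X \<in> obj C; X' \<in> obj C; A \<in> obj C; A' \<in> obj C;
        c \<in> carrier (mor C X' X); a \<in> carrier (mor C A A'); a' \<in> carrier (mor C A A');
        d \<in> carrier (bgrp F X A)\<rbrakk>
        \<Longrightarrow> bmap F c (a \<otimes>\<^bsub>mor C A A'\<^esub> a') d = bmap F c a d \<otimes>\<^bsub>bgrp F X' A'\<^esub> bmap F c a' d"

text \<open>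
  In \<open>\<EE>(X, A)\<close> the first argument is the end term.  A representative \<open>A \<rightarrow> B \<rightarrow> X\<close> of the class
  \<open>rlz C X A \<delta>\<close> (with maps \<open>x\<close>, \<open>y\<close>) is stored as the triple \<open>(B, x, y)\<close>.
\<close>

record ('o, 'm, 'e) extri_category = "('o, 'm) category" +
  ext :: "('o, 'm, 'e) bifunctor"
  rlz :: "'o \<Rightarrow> 'o \<Rightarrow> 'e \<Rightarrow> ('o \<times> 'm \<times> 'm) set"

definition push :: "('o, 'm, 'e, 'z) extri_category_scheme \<Rightarrow> 'o \<Rightarrow> 'm \<Rightarrow> 'e \<Rightarrow> 'e" where
  "push C X a \<delta> = bmap (ext C) (idn C X) a \<delta>"

definition pull :: "('o, 'm, 'e, 'z) extri_category_scheme \<Rightarrow> 'o \<Rightarrow> 'm \<Rightarrow> 'e \<Rightarrow> 'e" where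
  "pull C A c \<delta> = bmap (ext C) c (idn C A) \<delta>"

text \<open>The equivalence class \<open>[A \<rightarrow> B \<rightarrow> X]\<close>.\<close>

definition seq_class ::
  "('o, 'm, 'z) category_scheme \<Rightarrow> 'o \<Rightarrow> 'o \<Rightarrow> 'o \<Rightarrow> 'm \<Rightarrow> 'm \<Rightarrow> ('o \<times> 'm \<times> 'm) set" where
  "seq_class C A X B x y = {(B', x', y').
     B' \<in> obj C \<and> x' \<in> carrier (mor C A B') \<and> y' \<in> carrier (mor C B' X) \<and>
     (\<exists>b. is_iso C B B' b \<and> b \<cdot>\<^bsub>C\<^esub> x = x' \<and> y' \<cdot>\<^bsub>C\<^esub> b = y)}"

definition etriangle ::
  "('o, 'm, 'e, 'z) extri_category_scheme \<Rightarrow> 'o \<Rightarrow> 'm \<Rightarrow> 'o \<Rightarrow> 'm \<Rightarrow> 'o \<Rightarrow> 'e \<Rightarrow> bool" where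
  "etriangle C A x B y X \<delta> \<longleftrightarrow>
     A \<in> obj C \<and> B \<in> obj C \<and> X \<in> obj C \<and>
     x \<in> carrier (mor C A B) \<and> y \<in> carrier (mor C B X) \<and>
     \<delta> \<in> carrier (bgrp (ext C) X A) \<and> (B, x, y) \<in> rlz C X A \<delta>"

text \<open>
  In \<open>rlz_sum\<close>, the extension in the conclusion is \<open>\<delta> \<oplus> \<delta>'\<close>, i.e. the element of
  \<open>\<EE>(X \<oplus> X', A \<oplus> A')\<close> corresponding to \<open>(\<delta>, 0, 0, \<delta>')\<close>, and the two morphisms are
  \<open>x \<oplus> x'\<close> and \<open>y \<oplus> y'\<close>.
\<close>

locale extriangulated_category =
  additive_category C + additive_bifunctor C "ext C"
  for C :: "('o, 'm, 'e, 'z) extri_category_scheme" +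
  assumes rlz_class:
      "\<lbrakk>A \<in> obj C; X \<in> obj C; \<delta> \<in> carrier (bgrp (ext C) X A)\<rbrakk>
        \<Longrightarrow> \<exists>B\<in>obj C. \<exists>x\<in>carrier (mor C A B). \<exists>y\<in>carrier (mor C B X).
              rlz C X A \<delta> = seq_class C A X B x y"
    and rlz_morphism:
      "\<lbrakk>etriangle C A x B y X \<delta>; etriangle C A' x' B' y' X' \<delta>';
        a \<in> carrier (mor C A A'); c \<in> carrier (mor C X X'); push C X a \<delta> = pull C A' c \<delta>'\<rbrakk>
        \<Longrightarrow> \<exists>b\<in>carrier (mor C B B'). b \<cdot>\<^bsub>C\<^esub> x = x' \<cdot>\<^bsub>C\<^esub> a \<and> y' \<cdot>\<^bsub>C\<^esub> b = c \<cdot>\<^bsub>C\<^esub> y"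
    and rlz_zero:
      "is_biproduct C A X P i j p q \<Longrightarrow> (P, i, q) \<in> rlz C X A \<one>\<^bsub>bgrp (ext C) X A\<^esub>"
    and rlz_sum:
      "\<lbrakk>etriangle C A x B y X \<delta>; etriangle C A' x' B' y' X' \<delta>';
        is_biproduct C A A' AA iA jA pA qA;
        is_biproduct C B B' BB iB jB pB qB;
        is_biproduct C X X' XX iX jX pX qX\<rbrakk>
        \<Longrightarrow> (BB,
             (iB \<cdot>\<^bsub>C\<^esub> x \<cdot>\<^bsub>C\<^esub> pA) \<otimes>\<^bsub>mor C AA BB\<^esub> (jB \<cdot>\<^bsub>C\<^esub> x' \<cdot>\<^bsub>C\<^esub> qA),
             (iX \<cdot>\<^bsub>C\<^esub> y \<cdot>\<^bsub>C\<^esub> pB) \<otimes>\<^bsub>mor C BB XX\<^esub> (jX \<cdot>\<^bsub>C\<^esub> y' \<cdot>\<^bsub>C\<^esub> qB))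
            \<in> rlz C XX AA
                (bmap (ext C) pX iA \<delta> \<otimes>\<^bsub>bgrp (ext C) XX AA\<^esub> bmap (ext C) qX jA \<delta>')"
    and ET3:
      "\<lbrakk>etriangle C A x B y X \<delta>; etriangle C A' x' B' y' X' \<delta>';
        a \<in> carrier (mor C A A'); b \<in> carrier (mor C B B'); b \<cdot>\<^bsub>C\<^esub> x = x' \<cdot>\<^bsub>C\<^esub> a\<rbrakk>
        \<Longrightarrow> \<exists>c\<in>carrier (mor C X X'). c \<cdot>\<^bsub>C\<^esub> y = y' \<cdot>\<^bsub>C\<^esub> b \<and> push C X a \<delta> = pull C A' c \<delta>'"
    and ET3_op:
      "\<lbrakk>etriangle C A x B y X \<delta>; etriangle C A' x' B' y' X' \<delta>';
        b \<in> carrier (mor C B B'); c \<in> carrier (mor C X X'); c \<cdot>\<^bsub>C\<^esub> y = y' \<cdot>\<^bsub>C\<^esub> b\<rbrakk>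
        \<Longrightarrow> \<exists>a\<in>carrier (mor C A A'). b \<cdot>\<^bsub>C\<^esub> x = x' \<cdot>\<^bsub>C\<^esub> a \<and> push C X a \<delta> = pull C A' c \<delta>'"
    and ET4:
      "\<lbrakk>etriangle C A f B f' D \<delta>; etriangle C B g M g' F \<delta>'\<rbrakk>
        \<Longrightarrow> \<exists>E h' d e \<delta>''.
              etriangle C A (g \<cdot>\<^bsub>C\<^esub> f) M h' E \<delta>'' \<and>
              etriangle C D d E e F (push C F f' \<delta>') \<and>
              h' \<cdot>\<^bsub>C\<^esub> g = d \<cdot>\<^bsub>C\<^esub> f' \<and> e \<cdot>\<^bsub>C\<^esub> h' = g' \<and>
              pull C A d \<delta>'' = \<delta> \<and> push C E f \<delta>'' = pull C B e \<delta>'"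
    and ET4_op:
      "\<lbrakk>etriangle C D f' M f B \<delta>; etriangle C F g' B g A \<delta>'\<rbrakk>
        \<Longrightarrow> \<exists>E h' d e \<delta>''.
              etriangle C E h' M (g \<cdot>\<^bsub>C\<^esub> f) A \<delta>'' \<and>
              etriangle C D d E e F (pull C D g' \<delta>) \<and>
              f \<cdot>\<^bsub>C\<^esub> h' = g' \<cdot>\<^bsub>C\<^esub> e \<and> h' \<cdot>\<^bsub>C\<^esub> d = f' \<and>
              push C A e \<delta>'' = \<delta>' \<and> push C B d \<delta> = pull C E g \<delta>''"

record ('o, 'm, 'e, 'n) neg_extri_category = "('o, 'm, 'e) extri_category" +
  neg :: "('o, 'm, 'n) bifunctor"

definition exact_at ::
  "'a monoid \<Rightarrow> ('a \<Rightarrow> 'b) \<Rightarrow> 'b monoid \<Rightarrow> ('b \<Rightarrow> 'c) \<Rightarrow> 'c monoid \<Rightarrow> bool" where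
  "exact_at G f H g K \<longleftrightarrow> f \<in> hom G H \<and> g \<in> hom H K \<and> f ` carrier G = kernel H K g"

text \<open>
  Only the existence of connecting homomorphisms is required, for each \<open>\<EE>\<close>-triangle and each \<open>W\<close>;
  naturality in \<open>W\<close> is not assumed.
\<close>

locale neg_extriangulated_category =
  extriangulated_category C + neg_functor: additive_bifunctor C "neg C"
  for C :: "('o, 'm, 'e, 'n, 'z) neg_extri_category_scheme" +
  assumes neg_exact_covariant:
      "\<lbrakk>etriangle C A x B y X \<delta>; W \<in> obj C\<rbrakk>
        \<Longrightarrow> \<exists>con.
              exact_at (bgrp (neg C) W A) (bmap (neg C) (idn C W) x)
                       (bgrp (neg C) W B) (bmap (neg C) (idn C W) y) (bgrp (neg C) W X) \<and>
              exact_at (bgrp (neg C) W B) (bmap (neg C) (idn C W) y)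
                       (bgrp (neg C) W X) con (mor C W A) \<and>
              exact_at (bgrp (neg C) W X) con
                       (mor C W A) (\<lambda>f. x \<cdot>\<^bsub>C\<^esub> f) (mor C W B)"
    and neg_exact_contravariant:
      "\<lbrakk>etriangle C A x B y X \<delta>; W \<in> obj C\<rbrakk>
        \<Longrightarrow> \<exists>con.
              exact_at (bgrp (neg C) X W) (bmap (neg C) y (idn C W))
                       (bgrp (neg C) B W) (bmap (neg C) x (idn C W)) (bgrp (neg C) A W) \<and>
              exact_at (bgrp (neg C) B W) (bmap (neg C) x (idn C W))
                       (bgrp (neg C) A W) con (mor C X W) \<and>
              exact_at (bgrp (neg C) A W) con
                       (mor C X W) (\<lambda>f. f \<cdot>\<^bsub>C\<^esub> y) (mor C B W)"

text \<open>
  Full subcategories closed under isomorphisms are identified with their sets of objects.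
  \<open>restrict_category C S\<close> is the structure which an extension-closed \<open>S\<close> inherits from \<open>C\<close>.
\<close>

definition restrict_category ::
  "('o, 'm, 'e, 'n) neg_extri_category \<Rightarrow> 'o set \<Rightarrow> ('o, 'm, 'e, 'n) neg_extri_category" where
  "restrict_category C S =
     C\<lparr>obj := S, rlz := (\<lambda>X A \<delta>. {(B, x, y). (B, x, y) \<in> rlz C X A \<delta> \<and> B \<in> S})\<rparr>"

definition star ::
  "('o, 'm, 'e, 'z) extri_category_scheme \<Rightarrow> 'o set \<Rightarrow> 'o set \<Rightarrow> 'o set" where
  "star C \<X> \<Y> = {B. \<exists>A\<in>\<X>. \<exists>X\<in>\<Y>. \<exists>x y \<delta>. etriangle C A x B y X \<delta>}"

definition additive_subcategory :: "('o, 'm, 'z) category_scheme \<Rightarrow> 'o set \<Rightarrow> bool" where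
  "additive_subcategory C \<X> \<longleftrightarrow>
     \<X> \<subseteq> obj C \<and>
     (\<forall>A\<in>\<X>. \<forall>B\<in>obj C. (\<exists>f. is_iso C A B f) \<longrightarrow> B \<in> \<X>) \<and>
     (\<forall>Z\<in>obj C. idn C Z = \<one>\<^bsub>mor C Z Z\<^esub> \<longrightarrow> Z \<in> \<X>) \<and>
     (\<forall>A\<in>\<X>. \<forall>B\<in>\<X>. \<forall>P i j p q. is_biproduct C A B P i j p q \<longrightarrow> P \<in> \<X>)"

text \<open>
  A direct summand of \<open>B\<close> is an object \<open>A\<close> with maps \<open>A \<rightarrow> B \<rightarrow> A\<close> composing to the identity.  This
  does not require a complement of \<open>A\<close> to exist in \<open>C\<close>, which is not assumed to be weakly
  idempotent complete.
\<close>

definition closed_under_summands :: "('o, 'm, 'z) category_scheme \<Rightarrow> 'o set \<Rightarrow> bool" where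
  "closed_under_summands C \<X> \<longleftrightarrow>
     (\<forall>B\<in>\<X>. \<forall>A\<in>obj C.
        (\<exists>i\<in>carrier (mor C A B). \<exists>p\<in>carrier (mor C B A). p \<cdot>\<^bsub>C\<^esub> i = idn C A) \<longrightarrow> A \<in> \<X>)"

definition mor_vanish :: "('o, 'm, 'z) category_scheme \<Rightarrow> 'o set \<Rightarrow> 'o set \<Rightarrow> bool" where
  "mor_vanish C \<X> \<Y> \<longleftrightarrow> (\<forall>X\<in>\<X>. \<forall>Y\<in>\<Y>. carrier (mor C X Y) = {\<one>\<^bsub>mor C X Y\<^esub>})"

definition neg_vanish ::
  "('o, 'm, 'e, 'n, 'z) neg_extri_category_scheme \<Rightarrow> 'o set \<Rightarrow> 'o set \<Rightarrow> bool" where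
  "neg_vanish C \<X> \<Y> \<longleftrightarrow>
     (\<forall>X\<in>\<X>. \<forall>Y\<in>\<Y>. carrier (bgrp (neg C) X Y) = {\<one>\<^bsub>bgrp (neg C) X Y\<^esub>})"

fun torsion_pair ::
  "('o, 'm, 'e, 'n) neg_extri_category \<Rightarrow> 'o set \<times> 'o set \<Rightarrow> bool" where
  "torsion_pair C (\<U>, \<V>) \<longleftrightarrow>
     additive_subcategory C \<U> \<and> closed_under_summands C \<U> \<and>
     additive_subcategory C \<V> \<and> closed_under_summands C \<V> \<and>
     mor_vanish C \<U> \<V> \<and> obj C = star C \<U> \<V>"

fun s_torsion_pair ::
  "('o, 'm, 'e, 'n) neg_extri_category \<Rightarrow> 'o set \<times> 'o set \<Rightarrow> bool" where
  "s_torsion_pair C (\<U>, \<V>) \<longleftrightarrow> torsion_pair C (\<U>, \<V>) \<and> neg_vanish C \<U> \<V>"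

fun tp_le ::
  "('o, 'm, 'e, 'n) neg_extri_category \<Rightarrow> 'o set \<times> 'o set \<Rightarrow> 'o set \<times> 'o set \<Rightarrow> bool" where
  "tp_le C (\<U>1, \<V>1) (\<U>2, \<V>2) \<longleftrightarrow> mor_vanish C \<U>1 \<V>2 \<and> neg_vanish C \<U>1 \<V>2"

fun heart :: "'o set \<times> 'o set \<Rightarrow> 'o set \<times> 'o set \<Rightarrow> 'o set" where
  "heart (\<U>1, \<V>1) (\<U>2, \<V>2) = \<U>2 \<inter> \<V>1"

fun interval_Phi ::
  "'o set \<times> 'o set \<Rightarrow> 'o set \<times> 'o set \<Rightarrow> 'o set \<times> 'o set \<Rightarrow> 'o set \<times> 'o set" where
  "interval_Phi (\<U>1, \<V>1) (\<U>2, \<V>2) (\<U>, \<V>) = (\<U> \<inter> \<V>1, \<V> \<inter> \<U>2)"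

fun interval_Psi ::
  "('o, 'm, 'e, 'n) neg_extri_category \<Rightarrow>
   'o set \<times> 'o set \<Rightarrow> 'o set \<times> 'o set \<Rightarrow> 'o set \<times> 'o set \<Rightarrow> 'o set \<times> 'o set" where
  "interval_Psi C (\<U>1, \<V>1) (\<U>2, \<V>2) (\<T>, \<F>) = (star C \<U>1 \<T>, star C \<F> \<V>2)"

definition inverse_order_bijections ::
  "('a \<Rightarrow> 'b) \<Rightarrow> ('b \<Rightarrow> 'a) \<Rightarrow> 'a set \<Rightarrow> ('a \<Rightarrow> 'a \<Rightarrow> bool) \<Rightarrow> 'b set \<Rightarrow> ('b \<Rightarrow> 'b \<Rightarrow> bool) \<Rightarrow> bool"
  where
  "inverse_order_bijections f g A le\<^sub>A B le\<^sub>B \<longleftrightarrow>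
     bij_betw f A B \<and> bij_betw g B A \<and>
     (\<forall>a\<in>A. g (f a) = a) \<and> (\<forall>b\<in>B. f (g b) = b) \<and>
     (\<forall>a\<in>A. \<forall>a'\<in>A. le\<^sub>A a a' \<longrightarrow> le\<^sub>B (f a) (f a')) \<and>
     (\<forall>b\<in>B. \<forall>b'\<in>B. le\<^sub>B b b' \<longrightarrow> le\<^sub>A (g b) (g b'))"

end

theory Submission
  imports Defs
begin

text \<open>
  Everything rests on two observations.

  First, a torsion pair is an orthogonal pair: if \<open>Hom(X, \<V>) = 0\<close>, then in a triangle
  \<open>A \<rightarrow> X \<rightarrow> B\<close> with \<open>A \<in> \<U>\<close> and \<open>B \<in> \<V>\<close> the map \<open>X \<rightarrow> B\<close> vanishes, so the identity of \<open>X\<close> lifts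
  to \<open>A\<close> and \<open>X\<close> is a summand of \<open>A\<close>.  Hence \<open>\<U>\<close> and \<open>\<V>\<close> are each other's perpendicular classes.
  Conversely, perpendicular classes have all the closure properties that torsion pairs must have.
  This works relative to any class \<open>S\<close> of objects (\<open>torsion_pair_restrict_iff\<close>), so torsion pairs
  in the category and in the heart are handled alike, and a torsion pair can only contain another
  one componentwise if the two are equal (\<open>torsion_pair_on_unique\<close>).

  Second, the negative extensions control truncations.  If \<open>A \<rightarrow> X \<rightarrow> B\<close> is a triangle, then
  \<open>Hom(W, A)\<close> sits between \<open>\<EE>\<^sup>-\<^sup>1(W, B)\<close> and \<open>Hom(W, X)\<close>, and dually for \<open>Hom(B, W)\<close>.  With the
  assumed vanishing of \<open>\<EE>\<^sup>-\<^sup>1\<close> this transports \<open>X \<in> \<V>\<^sub>1\<close> to \<open>A\<close> and \<open>X \<in> \<U>\<^sub>2\<close> to \<open>B\<close>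
  (\<open>truncation_in_heart\<close>).

  The map \<open>\<Phi>\<close> is therefore well defined: the truncation triangle for \<open>(\<U>, \<V>)\<close> of an object of the
  heart stays inside the heart.  For \<open>\<Psi>\<close>, truncating any object first with \<open>t\<^sub>1\<close> and then the
  quotient with \<open>t\<^sub>2\<close> shows \<open>\<C> = \<U>\<^sub>1 * \<H> * \<V>\<^sub>2 = \<U>\<^sub>1 * (\<T> * \<F>) * \<V>\<^sub>2\<close>, and by associativity of \<open>*\<close>
  this is \<open>(\<U>\<^sub>1 * \<T>) * (\<F> * \<V>\<^sub>2)\<close>.  The same truncations identify \<open>\<U>\<^sub>1 * \<T>\<close> and \<open>\<F> * \<V>\<^sub>2\<close> with
  perpendicular classes (\<open>in_Psi_left\<close>, \<open>in_Psi_right\<close>), which yields their closure under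
  summands.  Both composites contain, or are contained in, the pair one starts with, so
  they are identities by uniqueness.  The vanishing conditions that define \<open>\<preccurlyeq>\<close> and \<open>s\<close>-torsion pairs
  restrict to subclasses and extend along \<open>*\<close>.
\<close>

section \<open>Exact sequences of an extension\<close>

context additive_category
begin

text \<open>
  Composing with a fixed morphism is additive, so it preserves the zero morphism, which is
  written \<open>\<one>\<close>.
\<close>

lemma cmp_one_right:
  assumes "A \<in> obj C" "B \<in> obj C" "D \<in> obj C" "g \<in> carrier (mor C B D)"
  shows "g \<cdot>\<^bsub>C\<^esub> \<one>\<^bsub>mor C A B\<^esub> = \<one>\<^bsub>mor C A D\<^esub>"
proof -
  interpret AB: comm_group "mor C A B" using assms by (intro mor_group)
  interpret AD: comm_group "mor C A D" using assms by (intro mor_group)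
  have cl: "g \<cdot>\<^bsub>C\<^esub> \<one>\<^bsub>mor C A B\<^esub> \<in> carrier (mor C A D)"
    using assms by (intro cmp_closed[of A B D]) auto
  have "g \<cdot>\<^bsub>C\<^esub> (\<one>\<^bsub>mor C A B\<^esub> \<otimes>\<^bsub>mor C A B\<^esub> \<one>\<^bsub>mor C A B\<^esub>)
      = (g \<cdot>\<^bsub>C\<^esub> \<one>\<^bsub>mor C A B\<^esub>) \<otimes>\<^bsub>mor C A D\<^esub> (g \<cdot>\<^bsub>C\<^esub> \<one>\<^bsub>mor C A B\<^esub>)"
    using assms by (intro cmp_add_right) auto
  then show ?thesis using cl by simp
qed

lemma cmp_one_left:
  assumes "A \<in> obj C" "B \<in> obj C" "D \<in> obj C" "f \<in> carrier (mor C A B)"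
  shows "\<one>\<^bsub>mor C B D\<^esub> \<cdot>\<^bsub>C\<^esub> f = \<one>\<^bsub>mor C A D\<^esub>"
proof -
  interpret BD: comm_group "mor C B D" using assms by (intro mor_group)
  interpret AD: comm_group "mor C A D" using assms by (intro mor_group)
  have cl: "\<one>\<^bsub>mor C B D\<^esub> \<cdot>\<^bsub>C\<^esub> f \<in> carrier (mor C A D)"
    using assms by (intro cmp_closed[of A B D]) auto
  have "(\<one>\<^bsub>mor C B D\<^esub> \<otimes>\<^bsub>mor C B D\<^esub> \<one>\<^bsub>mor C B D\<^esub>) \<cdot>\<^bsub>C\<^esub> f
      = (\<one>\<^bsub>mor C B D\<^esub> \<cdot>\<^bsub>C\<^esub> f) \<otimes>\<^bsub>mor C A D\<^esub> (\<one>\<^bsub>mor C B D\<^esub> \<cdot>\<^bsub>C\<^esub> f)"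
    using assms by (intro cmp_add_left) auto
  then show ?thesis using cl by simp
qed

lemma one_closed: "A \<in> obj C \<Longrightarrow> B \<in> obj C \<Longrightarrow> \<one>\<^bsub>mor C A B\<^esub> \<in> carrier (mor C A B)"
  by (meson comm_group.axioms(2) group.is_monoid mor_group monoid.one_closed)

lemma biproduct_zero_right:
  assumes "W \<in> obj C" "Z \<in> obj C" "idn C Z = \<one>\<^bsub>mor C Z Z\<^esub>"
  shows "is_biproduct C W Z W (idn C W) \<one>\<^bsub>mor C Z W\<^esub> (idn C W) \<one>\<^bsub>mor C W Z\<^esub>"
proof -
  interpret WW: comm_group "mor C W W" using assms by (intro mor_group)
  show ?thesis
    unfolding is_biproduct_def using assms
    by (simp add: one_closed idn_closed cmp_idn_left[of W W] cmp_one_left[of W Z W]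
        cmp_one_right[of Z W W] cmp_idn_right[of W Z] cmp_idn_left[of Z W] cmp_one_right[of Z W Z]
        cmp_one_left[of W W Z])
qed

lemma biproduct_zero_left:
  assumes "W \<in> obj C" "Z \<in> obj C" "idn C Z = \<one>\<^bsub>mor C Z Z\<^esub>"
  shows "is_biproduct C Z W W \<one>\<^bsub>mor C Z W\<^esub> (idn C W) \<one>\<^bsub>mor C W Z\<^esub> (idn C W)"
proof -
  interpret WW: comm_group "mor C W W" using assms by (intro mor_group)
  show ?thesis
    unfolding is_biproduct_def using assms
    by (simp add: one_closed idn_closed cmp_idn_left[of W W] cmp_one_left[of W Z W]
        cmp_one_right[of Z W W] cmp_idn_right[of W Z] cmp_idn_left[of Z W] cmp_one_right[of Z W Z]
        cmp_one_left[of W W Z])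
qed

end

lemma starI: "A \<in> \<X> \<Longrightarrow> B \<in> \<Y> \<Longrightarrow> etriangle C A x M y B \<delta> \<Longrightarrow> M \<in> star C \<X> \<Y>"
  unfolding star_def by blast

context extriangulated_category
begin

lemma zero_extension_closed:
  "A \<in> obj C \<Longrightarrow> X \<in> obj C \<Longrightarrow> \<one>\<^bsub>bgrp (ext C) X A\<^esub> \<in> carrier (bgrp (ext C) X A)"
  by (meson comm_group.axioms(2) group.is_monoid bgrp_group monoid.one_closed)

lemma etriangle_biproduct:
  assumes "is_biproduct C A X P i j p q"
  shows "etriangle C A i P q X \<one>\<^bsub>bgrp (ext C) X A\<^esub>"
  using assms rlz_zero[OF assms] zero_extension_closed
  unfolding etriangle_def is_biproduct_def by auto

text \<open>
  Exactness of \<open>Hom(W, A) \<rightarrow> Hom(W, B) \<rightarrow> Hom(W, X)\<close> in the middle.  The morphism \<open>f\<close> is the middle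
  component of a morphism from the split triangle \<open>W \<rightarrow> W \<rightarrow> 0\<close>, and the dual of (ET3) provides its
  first component, which is the lift.
\<close>

lemma lift_through_inflation:
  assumes tri: "etriangle C A x B y X \<delta>" and W: "W \<in> obj C"
    and f: "f \<in> carrier (mor C W B)" and yf: "y \<cdot>\<^bsub>C\<^esub> f = \<one>\<^bsub>mor C W X\<^esub>"
  shows "\<exists>a\<in>carrier (mor C W A). f = x \<cdot>\<^bsub>C\<^esub> a"
proof -
  have o: "A \<in> obj C" "B \<in> obj C" "X \<in> obj C" using tri by (auto simp: etriangle_def)
  obtain Z where Z: "Z \<in> obj C" "idn C Z = \<one>\<^bsub>mor C Z Z\<^esub>" using zero_object by auto
  note triW = etriangle_biproduct[OF biproduct_zero_right[OF W Z]]
  have "\<one>\<^bsub>mor C Z X\<^esub> \<cdot>\<^bsub>C\<^esub> \<one>\<^bsub>mor C W Z\<^esub> = y \<cdot>\<^bsub>C\<^esub> f"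
    using cmp_one_left[of W Z X] o W Z yf one_closed by simp
  from ET3_op[OF triW tri f _ this] one_closed[OF Z(1) o(3)]
  obtain a where "a \<in> carrier (mor C W A)" "f \<cdot>\<^bsub>C\<^esub> idn C W = x \<cdot>\<^bsub>C\<^esub> a" by blast
  then show ?thesis using cmp_idn_right[OF W o(2) f] by auto
qed

text \<open>
  The dual statement, from (ET3) and the split triangle \<open>0 \<rightarrow> W \<rightarrow> W\<close>.
\<close>

lemma factor_through_deflation:
  assumes tri: "etriangle C A x B y X \<delta>" and W: "W \<in> obj C"
    and f: "f \<in> carrier (mor C B W)" and fx: "f \<cdot>\<^bsub>C\<^esub> x = \<one>\<^bsub>mor C A W\<^esub>"
  shows "\<exists>c\<in>carrier (mor C X W). f = c \<cdot>\<^bsub>C\<^esub> y"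
proof -
  have o: "A \<in> obj C" "B \<in> obj C" "X \<in> obj C" using tri by (auto simp: etriangle_def)
  obtain Z where Z: "Z \<in> obj C" "idn C Z = \<one>\<^bsub>mor C Z Z\<^esub>" using zero_object by auto
  note triW = etriangle_biproduct[OF biproduct_zero_left[OF W Z]]
  have "f \<cdot>\<^bsub>C\<^esub> x = \<one>\<^bsub>mor C Z W\<^esub> \<cdot>\<^bsub>C\<^esub> \<one>\<^bsub>mor C A Z\<^esub>"
    using cmp_one_left[of A Z W] o W Z fx one_closed by simp
  from ET3[OF tri triW _ f this] one_closed[OF o(1) Z(1)]
  obtain c where "c \<in> carrier (mor C X W)" "c \<cdot>\<^bsub>C\<^esub> y = idn C W \<cdot>\<^bsub>C\<^esub> f" by blast
  then show ?thesis using cmp_idn_left[OF o(2) W f] by auto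
qed

lemma mor_vanishI:
  assumes "X \<subseteq> obj C" "Y \<subseteq> obj C"
    and "\<And>A B f. A \<in> X \<Longrightarrow> B \<in> Y \<Longrightarrow> f \<in> carrier (mor C A B) \<Longrightarrow> f = \<one>\<^bsub>mor C A B\<^esub>"
  shows "mor_vanish C X Y"
  using assms one_closed unfolding mor_vanish_def by blast

lemma mor_vanishD:
  "mor_vanish C X Y \<Longrightarrow> A \<in> X \<Longrightarrow> B \<in> Y \<Longrightarrow> f \<in> carrier (mor C A B) \<Longrightarrow> f = \<one>\<^bsub>mor C A B\<^esub>"
  unfolding mor_vanish_def by blast

lemma mor_vanish_mono:
  "mor_vanish C X Y \<Longrightarrow> X' \<subseteq> X \<Longrightarrow> Y' \<subseteq> Y \<Longrightarrow> mor_vanish C X' Y'"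
  unfolding mor_vanish_def by blast

lemma star_subset_obj: "star C \<X> \<Y> \<subseteq> obj C"
  by (auto simp: star_def etriangle_def)

lemma mor_vanish_star_right:
  assumes "\<W> \<subseteq> obj C" "mor_vanish C \<W> \<X>" "mor_vanish C \<W> \<Y>"
  shows "mor_vanish C \<W> (star C \<X> \<Y>)"
proof (rule mor_vanishI)
  fix W B f assume W: "W \<in> \<W>" and "B \<in> star C \<X> \<Y>" and f: "f \<in> carrier (mor C W B)"
  then obtain A X x y \<delta> where A: "A \<in> \<X>" "X \<in> \<Y>" and tri: "etriangle C A x B y X \<delta>"
    by (auto simp: star_def)
  have o: "W \<in> obj C" "A \<in> obj C" "B \<in> obj C" "X \<in> obj C"
    and xy: "x \<in> carrier (mor C A B)" "y \<in> carrier (mor C B X)"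
    using tri W assms by (auto simp: etriangle_def)
  have "y \<cdot>\<^bsub>C\<^esub> f = \<one>\<^bsub>mor C W X\<^esub>"
    using mor_vanishD[OF assms(3) W A(2)] cmp_closed[OF o(1,3,4) f xy(2)] by blast
  then obtain a where "a \<in> carrier (mor C W A)" "f = x \<cdot>\<^bsub>C\<^esub> a"
    using lift_through_inflation[OF tri o(1) f] by blast
  then show "f = \<one>\<^bsub>mor C W B\<^esub>"
    using mor_vanishD[OF assms(2) W A(1)] cmp_one_right[OF o(1-3) xy(1)] by auto
qed (use assms star_subset_obj in auto)

lemma mor_vanish_star_left:
  assumes "\<W> \<subseteq> obj C" "mor_vanish C \<X> \<W>" "mor_vanish C \<Y> \<W>"
  shows "mor_vanish C (star C \<X> \<Y>) \<W>"
proof (rule mor_vanishI)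
  fix W B f assume "B \<in> star C \<X> \<Y>" and W: "W \<in> \<W>" and f: "f \<in> carrier (mor C B W)"
  then obtain A X x y \<delta> where A: "A \<in> \<X>" "X \<in> \<Y>" and tri: "etriangle C A x B y X \<delta>"
    by (auto simp: star_def)
  have o: "W \<in> obj C" "A \<in> obj C" "B \<in> obj C" "X \<in> obj C"
    and xy: "x \<in> carrier (mor C A B)" "y \<in> carrier (mor C B X)"
    using tri W assms by (auto simp: etriangle_def)
  have "f \<cdot>\<^bsub>C\<^esub> x = \<one>\<^bsub>mor C A W\<^esub>"
    using mor_vanishD[OF assms(2) A(1) W] cmp_closed[OF o(2,3,1) xy(1) f] by blast
  then obtain c where "c \<in> carrier (mor C X W)" "f = c \<cdot>\<^bsub>C\<^esub> y"
    using factor_through_deflation[OF tri o(1) f] by blast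
  then show "f = \<one>\<^bsub>mor C B W\<^esub>"
    using mor_vanishD[OF assms(3) A(2) W] cmp_one_left[OF o(3,4,1) xy(2)] by auto
qed (use assms star_subset_obj in auto)

text \<open>
  The octahedral axiom (ET4) rebrackets an iterated extension to the right, its dual to the left.
\<close>

lemma star_assoc: "star C (star C \<X> \<Y>) \<Z> = star C \<X> (star C \<Y> \<Z>)"
proof (intro equalityI subsetI)
  fix M assume "M \<in> star C (star C \<X> \<Y>) \<Z>"
  then obtain A B D F f f' \<delta> g g' \<delta>' where "A \<in> \<X>" "D \<in> \<Y>" "F \<in> \<Z>"
    and tri: "etriangle C A f B f' D \<delta>" "etriangle C B g M g' F \<delta>'"
    by (auto simp: star_def)
  with ET4[OF tri] show "M \<in> star C \<X> (star C \<Y> \<Z>)"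
    unfolding star_def by blast
next
  fix M assume "M \<in> star C \<X> (star C \<Y> \<Z>)"
  then obtain A B D F f f' \<delta> g g' \<delta>' where "D \<in> \<X>" "F \<in> \<Y>" "A \<in> \<Z>"
    and tri: "etriangle C D f' M f B \<delta>" "etriangle C F g' B g A \<delta>'"
    by (auto simp: star_def)
  with ET4_op[OF tri] show "M \<in> star C (star C \<X> \<Y>) \<Z>"
    unfolding star_def by blast
qed

lemma star_mono: "\<X> \<subseteq> \<X>' \<Longrightarrow> \<Y> \<subseteq> \<Y>' \<Longrightarrow> star C \<X> \<Y> \<subseteq> star C \<X>' \<Y>'"
  unfolding star_def by blast

end

lemma exact_at_vanish:
  assumes "exact_at G f H g K" "group G" "group H" "group K"
    "carrier G = {\<one>\<^bsub>G\<^esub>}" "carrier K = {\<one>\<^bsub>K\<^esub>}"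
  shows "carrier H = {\<one>\<^bsub>H\<^esub>}"
proof -
  have f: "f \<in> hom G H" and g: "g \<in> hom H K" and e: "f ` carrier G = kernel H K g"
    using assms(1) by (auto simp: exact_at_def)
  have "f \<one>\<^bsub>G\<^esub> = \<one>\<^bsub>H\<^esub>" using hom_one[OF f] assms by blast
  moreover have "kernel H K g = carrier H"
    using g assms(6) unfolding kernel_def hom_def by auto
  ultimately show ?thesis using e assms(5) by simp
qed

context neg_extriangulated_category
begin

lemma neg_vanish_mono:
  "neg_vanish C X Y \<Longrightarrow> X' \<subseteq> X \<Longrightarrow> Y' \<subseteq> Y \<Longrightarrow> neg_vanish C X' Y'"
  unfolding neg_vanish_def by blast

lemma group_mor: "A \<in> obj C \<Longrightarrow> B \<in> obj C \<Longrightarrow> group (mor C A B)"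
  using mor_group comm_group_def by blast

lemma group_neg: "A \<in> obj C \<Longrightarrow> B \<in> obj C \<Longrightarrow> group (bgrp (neg C) A B)"
  using neg_functor.bgrp_group comm_group_def by blast

lemma neg_vanish_star_right:
  assumes "\<W> \<subseteq> obj C" "neg_vanish C \<W> \<X>" "neg_vanish C \<W> \<Y>"
  shows "neg_vanish C \<W> (star C \<X> \<Y>)"
  unfolding neg_vanish_def
proof (intro ballI)
  fix W B assume W: "W \<in> \<W>" and "B \<in> star C \<X> \<Y>"
  then obtain A X x y \<delta> where A: "A \<in> \<X>" "X \<in> \<Y>" and tri: "etriangle C A x B y X \<delta>"
    by (auto simp: star_def)
  have o: "W \<in> obj C" "A \<in> obj C" "B \<in> obj C" "X \<in> obj C"
    using tri W assms by (auto simp: etriangle_def)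
  have "exact_at (bgrp (neg C) W A) (bmap (neg C) (idn C W) x)
      (bgrp (neg C) W B) (bmap (neg C) (idn C W) y) (bgrp (neg C) W X)"
    using neg_exact_covariant[OF tri o(1)] by blast
  then show "carrier (bgrp (neg C) W B) = {\<one>\<^bsub>bgrp (neg C) W B\<^esub>}"
    by (rule exact_at_vanish) (use assms(2,3) A W o in \<open>auto simp: neg_vanish_def group_neg\<close>)
qed

lemma neg_vanish_star_left:
  assumes "\<W> \<subseteq> obj C" "neg_vanish C \<X> \<W>" "neg_vanish C \<Y> \<W>"
  shows "neg_vanish C (star C \<X> \<Y>) \<W>"
  unfolding neg_vanish_def
proof (intro ballI)
  fix W B assume "B \<in> star C \<X> \<Y>" and W: "W \<in> \<W>"
  then obtain A X x y \<delta> where A: "A \<in> \<X>" "X \<in> \<Y>" and tri: "etriangle C A x B y X \<delta>"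
    by (auto simp: star_def)
  have o: "W \<in> obj C" "A \<in> obj C" "B \<in> obj C" "X \<in> obj C"
    using tri W assms by (auto simp: etriangle_def)
  have "exact_at (bgrp (neg C) X W) (bmap (neg C) y (idn C W))
      (bgrp (neg C) B W) (bmap (neg C) x (idn C W)) (bgrp (neg C) A W)"
    using neg_exact_contravariant[OF tri o(1)] by blast
  then show "carrier (bgrp (neg C) B W) = {\<one>\<^bsub>bgrp (neg C) B W\<^esub>}"
    by (rule exact_at_vanish) (use assms(2,3) A W o in \<open>auto simp: neg_vanish_def group_neg\<close>)
qed

text \<open>
  Here and in the dual lemma below, the connecting homomorphisms out of \<open>\<EE>\<^sup>-\<^sup>1\<close> enter: \<open>Hom(W, A)\<close>
  lies between \<open>\<EE>\<^sup>-\<^sup>1(W, X)\<close> and \<open>Hom(W, B)\<close> in the long exact sequence.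
\<close>

lemma mor_vanish_first_term:
  assumes tri: "etriangle C A x B y X \<delta>" and "\<W> \<subseteq> obj C"
    and "neg_vanish C \<W> {X}" "mor_vanish C \<W> {B}"
  shows "mor_vanish C \<W> {A}"
  unfolding mor_vanish_def
proof clarify
  fix W assume W: "W \<in> \<W>"
  have o: "W \<in> obj C" "A \<in> obj C" "B \<in> obj C" "X \<in> obj C"
    using tri W assms by (auto simp: etriangle_def)
  obtain con where "exact_at (bgrp (neg C) W X) con (mor C W A) (\<lambda>f. x \<cdot>\<^bsub>C\<^esub> f) (mor C W B)"
    using neg_exact_covariant[OF tri o(1)] by blast
  then show "carrier (mor C W A) = {\<one>\<^bsub>mor C W A\<^esub>}"
    by (rule exact_at_vanish)
      (use assms(3,4) W o in \<open>auto simp: neg_vanish_def mor_vanish_def group_neg group_mor\<close>)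
qed

lemma mor_vanish_last_term:
  assumes tri: "etriangle C A x B y X \<delta>" and "\<W> \<subseteq> obj C"
    and "neg_vanish C {A} \<W>" "mor_vanish C {B} \<W>"
  shows "mor_vanish C {X} \<W>"
  unfolding mor_vanish_def
proof clarify
  fix W assume W: "W \<in> \<W>"
  have o: "W \<in> obj C" "A \<in> obj C" "B \<in> obj C" "X \<in> obj C"
    using tri W assms by (auto simp: etriangle_def)
  obtain con where "exact_at (bgrp (neg C) A W) con (mor C X W) (\<lambda>f. f \<cdot>\<^bsub>C\<^esub> y) (mor C B W)"
    using neg_exact_contravariant[OF tri o(1)] by blast
  then show "carrier (mor C X W) = {\<one>\<^bsub>mor C X W\<^esub>}"
    by (rule exact_at_vanish)
      (use assms(3,4) W o in \<open>auto simp: neg_vanish_def mor_vanish_def group_neg group_mor\<close>)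
qed

end

section \<open>Torsion pairs as orthogonal pairs\<close>

context additive_category
begin

lemma mor_vanish_summand_left:
  assumes o: "A \<in> obj C" "B \<in> obj C" "\<W> \<subseteq> obj C"
    and ip: "i \<in> carrier (mor C A B)" "p \<in> carrier (mor C B A)" "p \<cdot>\<^bsub>C\<^esub> i = idn C A"
    and B: "mor_vanish C {B} \<W>"
  shows "mor_vanish C {A} \<W>"
  unfolding mor_vanish_def
proof clarify
  fix W assume W: "W \<in> \<W>"
  then have oW: "W \<in> obj C" using o by auto
  have "f = \<one>\<^bsub>mor C A W\<^esub>" if f: "f \<in> carrier (mor C A W)" for f
  proof -
    have "(f \<cdot>\<^bsub>C\<^esub> p) \<cdot>\<^bsub>C\<^esub> i = f"
      by (simp only: ip(3) cmp_idn_right[OF o(1) oW f] flip: cmp_assoc[OF o(1,2,1) oW ip(1,2) f])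
    moreover have "f \<cdot>\<^bsub>C\<^esub> p = \<one>\<^bsub>mor C B W\<^esub>"
      using cmp_closed[OF o(2,1) oW ip(2) f] B W by (auto simp: mor_vanish_def)
    ultimately show ?thesis using cmp_one_left[OF o(1,2) oW ip(1)] by simp
  qed
  then show "carrier (mor C A W) = {\<one>\<^bsub>mor C A W\<^esub>}" using one_closed[OF o(1) oW] by blast
qed

lemma mor_vanish_summand_right:
  assumes o: "A \<in> obj C" "B \<in> obj C" "\<W> \<subseteq> obj C"
    and ip: "i \<in> carrier (mor C A B)" "p \<in> carrier (mor C B A)" "p \<cdot>\<^bsub>C\<^esub> i = idn C A"
    and B: "mor_vanish C \<W> {B}"
  shows "mor_vanish C \<W> {A}"
  unfolding mor_vanish_def
proof clarify
  fix W assume W: "W \<in> \<W>"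
  then have oW: "W \<in> obj C" using o by auto
  have "f = \<one>\<^bsub>mor C W A\<^esub>" if f: "f \<in> carrier (mor C W A)" for f
  proof -
    have "p \<cdot>\<^bsub>C\<^esub> (i \<cdot>\<^bsub>C\<^esub> f) = f"
      by (simp only: ip(3) cmp_idn_left[OF oW o(1) f] cmp_assoc[OF oW o(1,2,1) f ip(1,2)])
    moreover have "i \<cdot>\<^bsub>C\<^esub> f = \<one>\<^bsub>mor C W B\<^esub>"
      using cmp_closed[OF oW o(1,2) f ip(1)] B W by (auto simp: mor_vanish_def)
    ultimately show ?thesis using cmp_one_right[OF oW o(2,1) ip(2)] by simp
  qed
  then show "carrier (mor C W A) = {\<one>\<^bsub>mor C W A\<^esub>}" using one_closed[OF oW o(1)] by blast
qed

lemma mor_vanish_zero_left: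
  assumes "Z \<in> obj C" "idn C Z = \<one>\<^bsub>mor C Z Z\<^esub>" "\<W> \<subseteq> obj C"
  shows "mor_vanish C {Z} \<W>"
  unfolding mor_vanish_def
proof clarify
  fix W assume "W \<in> \<W>"
  then have W: "W \<in> obj C" using assms by auto
  have "f = \<one>\<^bsub>mor C Z W\<^esub>" if "f \<in> carrier (mor C Z W)" for f
    using cmp_idn_right[OF assms(1) W that] cmp_one_right[OF assms(1,1) W that] assms(2) by simp
  then show "carrier (mor C Z W) = {\<one>\<^bsub>mor C Z W\<^esub>}" using one_closed[OF assms(1) W] by blast
qed

lemma mor_vanish_zero_right:
  assumes "Z \<in> obj C" "idn C Z = \<one>\<^bsub>mor C Z Z\<^esub>" "\<W> \<subseteq> obj C"
  shows "mor_vanish C \<W> {Z}"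
  unfolding mor_vanish_def
proof clarify
  fix W assume "W \<in> \<W>"
  then have W: "W \<in> obj C" using assms by auto
  have "f = \<one>\<^bsub>mor C W Z\<^esub>" if "f \<in> carrier (mor C W Z)" for f
    using cmp_idn_left[OF W assms(1) that] cmp_one_left[OF W assms(1,1) that] assms(2) by simp
  then show "carrier (mor C W Z) = {\<one>\<^bsub>mor C W Z\<^esub>}" using one_closed[OF W assms(1)] by blast
qed

end

lemma mor_vanish_iff_left: "mor_vanish C \<X> \<Y> \<longleftrightarrow> (\<forall>X\<in>\<X>. mor_vanish C {X} \<Y>)"
  by (auto simp: mor_vanish_def)

lemma mor_vanish_iff_right: "mor_vanish C \<X> \<Y> \<longleftrightarrow> (\<forall>Y\<in>\<Y>. mor_vanish C \<X> {Y})"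
  by (auto simp: mor_vanish_def)

context extriangulated_category
begin

lemma biproduct_in_star:
  "is_biproduct C A B P i j p q \<Longrightarrow> P \<in> star C {A} {B}"
  using etriangle_biproduct unfolding star_def by blast

text \<open>
  A zero object in one factor makes the split triangles \<open>A \<rightarrow> A \<rightarrow> 0\<close> and \<open>0 \<rightarrow> A \<rightarrow> A\<close> available.
\<close>

lemma subset_star_left:
  assumes "Z \<in> \<Y>" "Z \<in> obj C" "idn C Z = \<one>\<^bsub>mor C Z Z\<^esub>" "\<X> \<subseteq> obj C"
  shows "\<X> \<subseteq> star C \<X> \<Y>"
  using etriangle_biproduct[OF biproduct_zero_right[OF _ assms(2,3)]] assms(1,4)
  unfolding star_def by blast

lemma subset_star_right:
  assumes "Z \<in> \<X>" "Z \<in> obj C" "idn C Z = \<one>\<^bsub>mor C Z Z\<^esub>" "\<Y> \<subseteq> obj C"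
  shows "\<Y> \<subseteq> star C \<X> \<Y>"
  using etriangle_biproduct[OF biproduct_zero_left[OF _ assms(2,3)]] assms(1,4)
  unfolding star_def by blast

end

lemma restrict_category_simps [simp]:
  "obj (restrict_category C S) = S"
  "mor (restrict_category C S) = mor C"
  "cmp (restrict_category C S) = cmp C"
  "idn (restrict_category C S) = idn C"
  "ext (restrict_category C S) = ext C"
  "neg (restrict_category C S) = neg C"
  by (simp_all add: restrict_category_def)

lemma mor_vanish_restrict [simp]: "mor_vanish (restrict_category C S) = mor_vanish C"
  by (simp add: mor_vanish_def fun_eq_iff)

lemma neg_vanish_restrict [simp]: "neg_vanish (restrict_category C S) = neg_vanish C"
  by (simp add: neg_vanish_def fun_eq_iff)

lemma tp_le_restrict [simp]: "tp_le (restrict_category C S) = tp_le C"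
  by (auto simp: fun_eq_iff)

lemma is_iso_restrict [simp]: "is_iso (restrict_category C S) = is_iso C"
  by (simp add: is_iso_def fun_eq_iff)

lemma is_biproduct_restrict:
  "S \<subseteq> obj C \<Longrightarrow> is_biproduct (restrict_category C S) A B P i j p q \<longleftrightarrow>
     {A, B, P} \<subseteq> S \<and> is_biproduct C A B P i j p q"
  by (auto simp: is_biproduct_def)

lemma etriangle_restrict:
  "S \<subseteq> obj C \<Longrightarrow> etriangle (restrict_category C S) A x B y X \<delta> \<longleftrightarrow>
     {A, B, X} \<subseteq> S \<and> etriangle C A x B y X \<delta>"
  by (auto simp: etriangle_def restrict_category_def)

lemma star_restrict:
  assumes "S \<subseteq> obj C" "\<X> \<subseteq> S" "\<Y> \<subseteq> S"
  shows "star (restrict_category C S) \<X> \<Y> = S \<inter> star C \<X> \<Y>"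
  unfolding star_def etriangle_restrict[OF assms(1)] using assms(2,3) by blast

text \<open>
  The orthogonality form of a torsion pair in the full subcategory on \<open>S\<close>.  Closure under sums and
  summands is implied by it, and the triangles and morphisms refer to the ambient category, so that pairs
  for different \<open>S\<close> can be compared directly.
\<close>

definition torsion_pair_on ::
  "('o, 'm, 'e, 'z) extri_category_scheme \<Rightarrow> 'o set \<Rightarrow> 'o set \<Rightarrow> 'o set \<Rightarrow> bool" where
  "torsion_pair_on C S \<T> \<F> \<longleftrightarrow>
     \<T> = {X\<in>S. mor_vanish C {X} \<F>} \<and> \<F> = {Y\<in>S. mor_vanish C \<T> {Y}} \<and> S \<subseteq> star C \<T> \<F>"

lemma torsion_pair_onD:
  assumes "torsion_pair_on C S \<T> \<F>"
  shows "\<And>X. X \<in> \<T> \<longleftrightarrow> X \<in> S \<and> mor_vanish C {X} \<F>"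
    and "\<And>Y. Y \<in> \<F> \<longleftrightarrow> Y \<in> S \<and> mor_vanish C \<T> {Y}"
    and "S \<subseteq> star C \<T> \<F>" and "\<T> \<subseteq> S" and "\<F> \<subseteq> S"
  using assms unfolding torsion_pair_on_def by blast+

lemma torsion_pair_on_triangle:
  assumes "torsion_pair_on C S \<T> \<F>" "X \<in> S"
  obtains A B x y \<delta> where "A \<in> \<T>" "B \<in> \<F>" "etriangle C A x X y B \<delta>"
  using torsion_pair_onD(3)[OF assms(1)] assms(2) unfolding star_def by blast

lemma torsion_pair_on_greatest:
  assumes "torsion_pair_on C S \<T> \<F>" "\<X> \<subseteq> S"
  shows "mor_vanish C \<X> \<F> \<Longrightarrow> \<X> \<subseteq> \<T>" and "mor_vanish C \<T> \<X> \<Longrightarrow> \<X> \<subseteq> \<F>"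
  using assms(2) torsion_pair_onD(1,2)[OF assms(1)]
    mor_vanish_iff_left[of C \<X> \<F>] mor_vanish_iff_right[of C \<T> \<X>] by blast+

lemma torsion_pair_on_vanish: "torsion_pair_on C S \<T> \<F> \<Longrightarrow> mor_vanish C \<T> \<F>"
  unfolding torsion_pair_on_def using mor_vanish_iff_left by blast

lemma torsion_pair_on_orthogonalI:
  assumes "\<T> \<subseteq> S" "\<F> \<subseteq> S" "mor_vanish C \<T> \<F>" "S \<subseteq> star C \<T> \<F>"
    and "\<And>X. X \<in> S \<Longrightarrow> mor_vanish C {X} \<F> \<Longrightarrow> X \<in> \<T>"
    and "\<And>Y. Y \<in> S \<Longrightarrow> mor_vanish C \<T> {Y} \<Longrightarrow> Y \<in> \<F>"
  shows "torsion_pair_on C S \<T> \<F>"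
proof -
  have "mor_vanish C {X} \<F>" if "X \<in> \<T>" for X using assms(3) that by (simp add: mor_vanish_def)
  moreover have "mor_vanish C \<T> {Y}" if "Y \<in> \<F>" for Y using assms(3) that by (simp add: mor_vanish_def)
  ultimately show ?thesis unfolding torsion_pair_on_def using assms(1,2,4-6) by blast
qed

text \<open>
  Taking perpendicular classes reverses inclusions: \<open>\<T>'\<close> is orthogonal to \<open>\<F>'\<close>, hence to \<open>\<F>\<close>, and so
  lies in \<open>\<T>\<close>.
\<close>

lemma torsion_pair_on_unique:
  assumes "torsion_pair_on C S \<T> \<F>" "torsion_pair_on C S \<T>' \<F>'" "\<T> \<subseteq> \<T>'" "\<F> \<subseteq> \<F>'"
  shows "\<T> = \<T>'" "\<F> = \<F>'"
proof -
  note v = torsion_pair_on_vanish[OF assms(2)]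
  have "mor_vanish C \<T>' \<F>" "mor_vanish C \<T> \<F>'"
    using v assms(3,4) unfolding mor_vanish_def by blast+
  with assms(2) have "\<T>' \<subseteq> \<T>" "\<F>' \<subseteq> \<F>"
    using torsion_pair_on_greatest(1)[OF assms(1), of \<T>'] torsion_pair_on_greatest(2)[OF assms(1), of \<F>']
      torsion_pair_onD(4,5)[OF assms(2)] by simp_all
  then show "\<T> = \<T>'" "\<F> = \<F>'" using assms(3,4) by blast+
qed

text \<open>
  Restriction to a class of objects is an operation on the plain record type, hence the scheme
  parameter is fixed here.
\<close>

locale neg_extriangulated =
  neg_extriangulated_category C for C :: "('o, 'm, 'e, 'n) neg_extri_category"
begin

text \<open>
  An isomorphic copy is a summand and a biproduct is a split extension, so that closure under summands and
  extensions covers most of the definition.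
\<close>

lemma additive_subcategoryI:
  assumes S: "S \<subseteq> obj C" and X: "\<X> \<subseteq> S"
    and summands: "closed_under_summands (restrict_category C S) \<X>"
    and zero: "\<And>Z. Z \<in> S \<Longrightarrow> idn C Z = \<one>\<^bsub>mor C Z Z\<^esub> \<Longrightarrow> Z \<in> \<X>"
    and ext: "S \<inter> star C \<X> \<X> \<subseteq> \<X>"
  shows "additive_subcategory (restrict_category C S) \<X>"
proof -
  have "B \<in> \<X>" if "A \<in> \<X>" "B \<in> S" "is_iso C A B f" for A B f
    using summands that unfolding closed_under_summands_def is_iso_def restrict_category_simps
    by blast
  moreover have "P \<in> \<X>"
    if "A \<in> \<X>" "B \<in> \<X>" "is_biproduct (restrict_category C S) A B P i j p q" for A B P i j p q
  proof -
    have P: "P \<in> S" "is_biproduct C A B P i j p q" using is_biproduct_restrict[OF S] that(3) by auto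
    have "P \<in> star C {A} {B}" using biproduct_in_star[OF P(2)] .
    then have "P \<in> star C \<X> \<X>" using star_mono[of "{A}" \<X> "{B}" \<X>] that by blast
    then show ?thesis using P(1) ext by blast
  qed
  ultimately show ?thesis
    using X zero unfolding additive_subcategory_def restrict_category_simps is_iso_restrict by blast
qed

lemma left_perp_closed:
  assumes S: "S \<subseteq> obj C" and W: "\<W> \<subseteq> obj C"
  defines "\<X> \<equiv> {X\<in>S. mor_vanish C {X} \<W>}"
  shows "closed_under_summands (restrict_category C S) \<X>"
    and "additive_subcategory (restrict_category C S) \<X>"
proof -
  show cs: "closed_under_summands (restrict_category C S) \<X>"
    unfolding closed_under_summands_def \<X>_def
    using S mor_vanish_summand_left[OF _ _ W] by auto blast
  have "mor_vanish C \<X> \<W>" unfolding \<X>_def mor_vanish_def by auto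
  then have "mor_vanish C (star C \<X> \<X>) \<W>" using mor_vanish_star_left[OF W] by blast
  then have "S \<inter> star C \<X> \<X> \<subseteq> \<X>" unfolding \<X>_def mor_vanish_def by blast
  then show "additive_subcategory (restrict_category C S) \<X>"
    using S W cs mor_vanish_zero_left by (intro additive_subcategoryI) (auto simp: \<X>_def)
qed

lemma right_perp_closed:
  assumes S: "S \<subseteq> obj C" and W: "\<W> \<subseteq> obj C"
  defines "\<Y> \<equiv> {Y\<in>S. mor_vanish C \<W> {Y}}"
  shows "closed_under_summands (restrict_category C S) \<Y>"
    and "additive_subcategory (restrict_category C S) \<Y>"
proof -
  show cs: "closed_under_summands (restrict_category C S) \<Y>"
    unfolding closed_under_summands_def \<Y>_def
    using S mor_vanish_summand_right[OF _ _ W] by auto blast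
  have "mor_vanish C \<W> \<Y>" unfolding \<Y>_def mor_vanish_def by auto
  then have "mor_vanish C \<W> (star C \<Y> \<Y>)" using mor_vanish_star_right[OF W] by blast
  then have "S \<inter> star C \<Y> \<Y> \<subseteq> \<Y>" unfolding \<Y>_def mor_vanish_def by blast
  then show "additive_subcategory (restrict_category C S) \<Y>"
    using S W cs mor_vanish_zero_right by (intro additive_subcategoryI) (auto simp: \<Y>_def)
qed

text \<open>
  If \<open>Hom(X, \<F>) = 0\<close>, the second map of a triangle \<open>A \<rightarrow> X \<rightarrow> B\<close> with \<open>A \<in> \<T>\<close> and \<open>B \<in> \<F>\<close> is zero,
  and lifting the identity along the first one makes \<open>X\<close> a summand of \<open>A\<close>.
\<close>

lemma torsion_pair_onI:
  assumes S: "S \<subseteq> obj C" and sub: "\<T> \<subseteq> S" "\<F> \<subseteq> S"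
    and T: "closed_under_summands (restrict_category C S) \<T>"
    and F: "closed_under_summands (restrict_category C S) \<F>"
    and van: "mor_vanish C \<T> \<F>" and star: "S \<subseteq> star C \<T> \<F>"
  shows "torsion_pair_on C S \<T> \<F>"
proof -
  have "X \<in> \<T>" if X: "X \<in> S" "mor_vanish C {X} \<F>" for X
  proof -
    obtain A B x y \<delta> where AB: "A \<in> \<T>" "B \<in> \<F>" and tri: "etriangle C A x X y B \<delta>"
      using X star by (auto simp: star_def)
    have o: "A \<in> obj C" "X \<in> obj C" "B \<in> obj C"
      and xy: "x \<in> carrier (mor C A X)" "y \<in> carrier (mor C X B)"
      using tri by (auto simp: etriangle_def)
    have "y = \<one>\<^bsub>mor C X B\<^esub>" using mor_vanishD[OF X(2) _ AB(2) xy(2)] by simp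
    then have "y \<cdot>\<^bsub>C\<^esub> idn C X = \<one>\<^bsub>mor C X B\<^esub>" using cmp_idn_right[OF o(2,3) xy(2)] by simp
    then obtain a where "a \<in> carrier (mor C X A)" "x \<cdot>\<^bsub>C\<^esub> a = idn C X"
      using lift_through_inflation[OF tri o(2) idn_closed[OF o(2)]] by auto
    then show ?thesis using T AB(1) X(1) xy(1) unfolding closed_under_summands_def by auto
  qed
  moreover have "Y \<in> \<F>" if Y: "Y \<in> S" "mor_vanish C \<T> {Y}" for Y
  proof -
    obtain A B x y \<delta> where AB: "A \<in> \<T>" "B \<in> \<F>" and tri: "etriangle C A x Y y B \<delta>"
      using Y star by (auto simp: star_def)
    have o: "A \<in> obj C" "Y \<in> obj C" "B \<in> obj C"
      and xy: "x \<in> carrier (mor C A Y)" "y \<in> carrier (mor C Y B)"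
      using tri by (auto simp: etriangle_def)
    have "x = \<one>\<^bsub>mor C A Y\<^esub>" using mor_vanishD[OF Y(2) AB(1) _ xy(1)] by simp
    then have "idn C Y \<cdot>\<^bsub>C\<^esub> x = \<one>\<^bsub>mor C A Y\<^esub>" using cmp_idn_left[OF o(1,2) xy(1)] by simp
    then obtain c where "c \<in> carrier (mor C B Y)" "c \<cdot>\<^bsub>C\<^esub> y = idn C Y"
      using factor_through_deflation[OF tri o(2) idn_closed[OF o(2)]] by auto
    then show ?thesis using F AB(2) Y(1) xy(2) unfolding closed_under_summands_def by auto
  qed
  ultimately show ?thesis using sub van star by (blast intro: torsion_pair_on_orthogonalI)
qed

text \<open>
  The bridge between the definition of torsion pairs and orthogonality, for the heart and, with
  \<open>S = obj C\<close>, for the whole category.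
\<close>

theorem torsion_pair_restrict_iff:
  assumes S: "S \<subseteq> obj C"
  shows "torsion_pair (restrict_category C S) (\<T>, \<F>) \<longleftrightarrow> torsion_pair_on C S \<T> \<F>"
proof
  assume tp: "torsion_pair (restrict_category C S) (\<T>, \<F>)"
  then have sub: "\<T> \<subseteq> S" "\<F> \<subseteq> S" by (auto simp: additive_subcategory_def)
  show "torsion_pair_on C S \<T> \<F>"
    using tp star_restrict[OF S sub]
    unfolding torsion_pair.simps mor_vanish_restrict restrict_category_simps
    by (intro torsion_pair_onI[OF S sub]; blast)
next
  assume tp: "torsion_pair_on C S \<T> \<F>"
  then have sub: "\<T> \<subseteq> S" "\<F> \<subseteq> S"
    and T: "\<T> = {X\<in>S. mor_vanish C {X} \<F>}" and F: "\<F> = {Y\<in>S. mor_vanish C \<T> {Y}}"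
    unfolding torsion_pair_on_def by blast+
  have o: "\<T> \<subseteq> obj C" "\<F> \<subseteq> obj C" using sub S by auto
  show "torsion_pair (restrict_category C S) (\<T>, \<F>)"
    using left_perp_closed[OF S o(2), folded T] right_perp_closed[OF S o(1), folded F]
      torsion_pair_on_vanish[OF tp] star_restrict[OF S sub] tp
    unfolding torsion_pair.simps mor_vanish_restrict restrict_category_simps torsion_pair_on_def
    by blast
qed

corollary torsion_pair_iff: "torsion_pair C (\<U>, \<V>) \<longleftrightarrow> torsion_pair_on C (obj C) \<U> \<V>"
proof -
  have "etriangle (restrict_category C (obj C)) = etriangle C"
    by (intro ext) (auto simp: etriangle_def restrict_category_def)
  then have "star (restrict_category C (obj C)) = star C"
    by (simp add: star_def fun_eq_iff)
  moreover have "closed_under_summands (restrict_category C (obj C)) = closed_under_summands C"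
    "is_biproduct (restrict_category C (obj C)) = is_biproduct C"
    by (simp_all add: closed_under_summands_def is_biproduct_def fun_eq_iff)
  ultimately have "torsion_pair (restrict_category C (obj C)) (\<U>, \<V>) = torsion_pair C (\<U>, \<V>)"
    by (simp add: additive_subcategory_def)
  then show ?thesis using torsion_pair_restrict_iff[of "obj C"] by simp
qed

text \<open>
  A torsion pair restricts to every class that contains the truncations of its objects: the intersections with
  \<open>S'\<close> are perpendicular classes inside \<open>S'\<close> and thereby closed under summands.
\<close>

lemma torsion_pair_on_subset:
  assumes tp: "torsion_pair_on C S \<U> \<V>" and S: "S' \<subseteq> S" "S \<subseteq> obj C"
    and star: "S' \<subseteq> star C (\<U> \<inter> S') (\<V> \<inter> S')"
  shows "torsion_pair_on C S' (\<U> \<inter> S') (\<V> \<inter> S')"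
proof -
  have o: "\<U> \<subseteq> obj C" "\<V> \<subseteq> obj C" "S' \<subseteq> obj C"
    using torsion_pair_onD(4,5)[OF tp] S by auto
  have eq: "\<U> \<inter> S' = {X\<in>S'. mor_vanish C {X} \<V>}" "\<V> \<inter> S' = {Y\<in>S'. mor_vanish C \<U> {Y}}"
    using torsion_pair_onD(1,2)[OF tp] S(1) by blast+
  show ?thesis
    using left_perp_closed(1)[OF o(3,2), folded eq] right_perp_closed(1)[OF o(3,1), folded eq]
      mor_vanish_mono[OF torsion_pair_on_vanish[OF tp]] star o(3)
    by (intro torsion_pair_onI) blast+
qed

lemma torsion_pair_on_zero:
  assumes "torsion_pair_on C S \<T> \<F>" "S \<subseteq> obj C" "Z \<in> S" "idn C Z = \<one>\<^bsub>mor C Z Z\<^esub>"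
  shows "Z \<in> \<T>" "Z \<in> \<F>"
  using assms mor_vanish_zero_left[of Z \<F>] mor_vanish_zero_right[of Z \<T>]
  unfolding torsion_pair_on_def by blast+

end

section \<open>The interval between two torsion pairs\<close>

locale torsion_interval = neg_extriangulated C
  for C :: "('o, 'm, 'e, 'n) neg_extri_category" +
  fixes \<U>\<^sub>1 \<V>\<^sub>1 \<U>\<^sub>2 \<V>\<^sub>2 :: "'o set"
  assumes t1: "torsion_pair_on C (obj C) \<U>\<^sub>1 \<V>\<^sub>1"
    and t2: "torsion_pair_on C (obj C) \<U>\<^sub>2 \<V>\<^sub>2"
    and mor_12: "mor_vanish C \<U>\<^sub>1 \<V>\<^sub>2"
    and neg_12: "neg_vanish C \<U>\<^sub>1 \<V>\<^sub>2"
begin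

abbreviation "\<H> \<equiv> \<U>\<^sub>2 \<inter> \<V>\<^sub>1"

lemma sub_obj: "\<U>\<^sub>1 \<subseteq> obj C" "\<V>\<^sub>1 \<subseteq> obj C" "\<U>\<^sub>2 \<subseteq> obj C" "\<V>\<^sub>2 \<subseteq> obj C" "\<H> \<subseteq> obj C"
  using torsion_pair_onD(4,5)[OF t1] torsion_pair_onD(4,5)[OF t2] by auto

lemma V1_iff: "Y \<in> \<V>\<^sub>1 \<longleftrightarrow> Y \<in> obj C \<and> mor_vanish C \<U>\<^sub>1 {Y}"
  using torsion_pair_onD(2)[OF t1] .

lemma U2_iff: "X \<in> \<U>\<^sub>2 \<longleftrightarrow> X \<in> obj C \<and> mor_vanish C {X} \<V>\<^sub>2"
  using torsion_pair_onD(1)[OF t2] .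

text \<open>
  How negative extensions enter the argument: \<open>Hom(\<U>\<^sub>1, A)\<close> is squeezed between \<open>\<EE>\<^sup>-\<^sup>1(\<U>\<^sub>1, B)\<close> and
  \<open>Hom(\<U>\<^sub>1, X)\<close>, and \<open>Hom(B, \<V>\<^sub>2)\<close> between \<open>\<EE>\<^sup>-\<^sup>1(A, \<V>\<^sub>2)\<close> and \<open>Hom(X, \<V>\<^sub>2)\<close>.
\<close>

lemma truncation_in_heart:
  assumes tri: "etriangle C A x X y B \<delta>"
  shows "X \<in> \<V>\<^sub>1 \<Longrightarrow> neg_vanish C \<U>\<^sub>1 {B} \<Longrightarrow> A \<in> \<V>\<^sub>1"
    and "X \<in> \<U>\<^sub>2 \<Longrightarrow> neg_vanish C {A} \<V>\<^sub>2 \<Longrightarrow> B \<in> \<U>\<^sub>2"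
  using tri mor_vanish_first_term[OF tri sub_obj(1)] mor_vanish_last_term[OF tri sub_obj(4)]
  by (auto simp: V1_iff U2_iff etriangle_def)

text \<open>
  Since \<open>\<U> \<subseteq> \<U>\<^sub>2\<close> and \<open>\<V> \<subseteq> \<V>\<^sub>1\<close>, the map \<open>\<Phi>\<close> just intersects both classes with the heart.
\<close>

lemma torsion_pair_on_Phi:
  assumes t: "torsion_pair_on C (obj C) \<U> \<V>"
    and l: "mor_vanish C \<U>\<^sub>1 \<V>" "neg_vanish C \<U>\<^sub>1 \<V>"
    and r: "mor_vanish C \<U> \<V>\<^sub>2" "neg_vanish C \<U> \<V>\<^sub>2"
  shows "torsion_pair_on C \<H> (\<U> \<inter> \<V>\<^sub>1) (\<V> \<inter> \<U>\<^sub>2)"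
proof -
  have UV: "\<U> \<subseteq> \<U>\<^sub>2" "\<V> \<subseteq> \<V>\<^sub>1"
    using torsion_pair_onD(4,5)[OF t] l(1) r(1)
      mor_vanish_iff_left[of C \<U>] mor_vanish_iff_right[of C _ \<V>]
    by (auto simp: U2_iff V1_iff)
  then have eq: "\<U> \<inter> \<V>\<^sub>1 = \<U> \<inter> \<H>" "\<V> \<inter> \<U>\<^sub>2 = \<V> \<inter> \<H>" by auto
  have "X \<in> star C (\<U> \<inter> \<H>) (\<V> \<inter> \<H>)" if X: "X \<in> \<H>" for X
  proof -
    obtain A B x y \<delta> where AB: "A \<in> \<U>" "B \<in> \<V>" and tri: "etriangle C A x X y B \<delta>"
      using torsion_pair_on_triangle[OF t] X sub_obj(5) by blast
    have "A \<in> \<H>" "B \<in> \<H>"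
      using truncation_in_heart[OF tri] X AB UV neg_vanish_mono[OF l(2)] neg_vanish_mono[OF r(2)]
      by auto
    then show ?thesis using AB tri by (blast intro: starI)
  qed
  then show ?thesis
    unfolding eq using sub_obj(5) by (intro torsion_pair_on_subset[OF t]) auto
qed

context
  fixes \<T> \<F>
  assumes tf: "torsion_pair_on C \<H> \<T> \<F>"
    and neg_T: "neg_vanish C \<T> \<V>\<^sub>2" and neg_F: "neg_vanish C \<U>\<^sub>1 \<F>"
begin

lemma heart_sub: "\<T> \<subseteq> \<H>" "\<F> \<subseteq> \<H>" "\<T> \<subseteq> obj C" "\<F> \<subseteq> obj C"
  using torsion_pair_onD(4,5)[OF tf] sub_obj(5) by auto

lemma mor_heart: "mor_vanish C \<U>\<^sub>1 \<F>" "mor_vanish C \<T> \<V>\<^sub>2"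
  using mor_vanish_mono[OF torsion_pair_on_vanish[OF t1]]
    mor_vanish_mono[OF torsion_pair_on_vanish[OF t2]] heart_sub by auto

lemma subset_Psi:
  "\<U>\<^sub>1 \<subseteq> star C \<U>\<^sub>1 \<T>" "\<T> \<subseteq> star C \<U>\<^sub>1 \<T>" "\<F> \<subseteq> star C \<F> \<V>\<^sub>2" "\<V>\<^sub>2 \<subseteq> star C \<F> \<V>\<^sub>2"
proof -
  obtain Z where Z: "Z \<in> obj C" "idn C Z = \<one>\<^bsub>mor C Z Z\<^esub>" using zero_object by auto
  have in12: "Z \<in> \<U>\<^sub>1" "Z \<in> \<V>\<^sub>1" "Z \<in> \<U>\<^sub>2" "Z \<in> \<V>\<^sub>2"
    using torsion_pair_on_zero[OF t1 _ Z] torsion_pair_on_zero[OF t2 _ Z] by auto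
  then have "Z \<in> \<T>" "Z \<in> \<F>" using torsion_pair_on_zero[OF tf sub_obj(5) _ Z(2)] by auto
  then show "\<U>\<^sub>1 \<subseteq> star C \<U>\<^sub>1 \<T>" "\<T> \<subseteq> star C \<U>\<^sub>1 \<T>" "\<F> \<subseteq> star C \<F> \<V>\<^sub>2" "\<V>\<^sub>2 \<subseteq> star C \<F> \<V>\<^sub>2"
    using in12 sub_obj heart_sub Z subset_star_left subset_star_right by auto
qed

text \<open>
  Truncating \<open>X\<close> with respect to \<open>t\<^sub>1\<close> leaves a quotient \<open>B \<in> \<V>\<^sub>1\<close>.  Negative extensions of \<open>\<U>\<^sub>1\<close> by
  \<open>\<V>\<^sub>2\<close> and by \<open>\<F>\<close> vanish, so \<open>B\<close> inherits from \<open>X\<close> the orthogonality to both classes.  The first puts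
  \<open>B\<close> into the heart and the second into \<open>\<T>\<close>.
\<close>

lemma in_Psi_left:
  assumes X: "X \<in> obj C" and XF: "mor_vanish C {X} \<F>" and XV: "mor_vanish C {X} \<V>\<^sub>2"
  shows "X \<in> star C \<U>\<^sub>1 \<T>"
proof -
  obtain A B x y \<delta> where AB: "A \<in> \<U>\<^sub>1" "B \<in> \<V>\<^sub>1" and tri: "etriangle C A x X y B \<delta>"
    using torsion_pair_on_triangle[OF t1 X] .
  have "B \<in> \<H>"
    using truncation_in_heart(2)[OF tri] X XV AB neg_vanish_mono[OF neg_12] by (auto simp: U2_iff)
  moreover have "mor_vanish C {B} \<F>"
    using mor_vanish_last_term[OF tri heart_sub(4) neg_vanish_mono[OF neg_F] XF] AB by auto
  ultimately have "B \<in> \<T>" using torsion_pair_onD(1)[OF tf] by blast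
  then show ?thesis using AB tri by (blast intro: starI)
qed

text \<open>
  The dual argument, with the truncation for \<open>t\<^sub>2\<close>.
\<close>

lemma in_Psi_right:
  assumes Y: "Y \<in> obj C" and UY: "mor_vanish C \<U>\<^sub>1 {Y}" and TY: "mor_vanish C \<T> {Y}"
  shows "Y \<in> star C \<F> \<V>\<^sub>2"
proof -
  obtain A B x y \<delta> where AB: "A \<in> \<U>\<^sub>2" "B \<in> \<V>\<^sub>2" and tri: "etriangle C A x Y y B \<delta>"
    using torsion_pair_on_triangle[OF t2 Y] .
  have "A \<in> \<H>"
    using truncation_in_heart(1)[OF tri] Y UY AB neg_vanish_mono[OF neg_12] by (auto simp: V1_iff)
  moreover have "mor_vanish C \<T> {A}"
    using mor_vanish_first_term[OF tri heart_sub(3) neg_vanish_mono[OF neg_T] TY] AB by auto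
  ultimately have "A \<in> \<F>" using torsion_pair_onD(2)[OF tf] by blast
  then show ?thesis using AB tri by (blast intro: starI)
qed

text \<open>
  In the triangle \<open>B1 \<rightarrow> B \<rightarrow> B2\<close> that truncates the \<open>t\<^sub>1\<close>-quotient \<open>B \<in> \<V>\<^sub>1\<close> with respect to \<open>t\<^sub>2\<close>, the first
  term stays in \<open>\<V>\<^sub>1\<close> because \<open>\<EE>\<^sup>-\<^sup>1(\<U>\<^sub>1, \<V>\<^sub>2) = 0\<close>.
\<close>

lemma obj_subset_star_heart: "obj C \<subseteq> star C \<U>\<^sub>1 (star C \<H> \<V>\<^sub>2)"
proof
  fix X assume "X \<in> obj C"
  then obtain A B x y \<delta> where AB: "A \<in> \<U>\<^sub>1" "B \<in> \<V>\<^sub>1" and tri: "etriangle C A x X y B \<delta>"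
    using torsion_pair_on_triangle[OF t1] by blast
  obtain B1 B2 x' y' \<delta>' where B: "B1 \<in> \<U>\<^sub>2" "B2 \<in> \<V>\<^sub>2" and tri': "etriangle C B1 x' B y' B2 \<delta>'"
    using torsion_pair_on_triangle[OF t2] AB(2) sub_obj(2) by blast
  have "B1 \<in> \<V>\<^sub>1" using truncation_in_heart(1)[OF tri'] AB B neg_vanish_mono[OF neg_12] by auto
  then have "B \<in> star C \<H> \<V>\<^sub>2" using B tri' by (blast intro: starI)
  then show "X \<in> star C \<U>\<^sub>1 (star C \<H> \<V>\<^sub>2)" using AB tri by (blast intro: starI)
qed

lemma neg_Psi:
  "neg_vanish C \<U>\<^sub>1 (star C \<F> \<V>\<^sub>2)" "neg_vanish C (star C \<U>\<^sub>1 \<T>) \<V>\<^sub>2"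
  using neg_vanish_star_right[OF sub_obj(1) neg_F neg_12]
    neg_vanish_star_left[OF sub_obj(4) neg_12 neg_T] by auto

lemma mor_Psi:
  "mor_vanish C \<U>\<^sub>1 (star C \<F> \<V>\<^sub>2)" "mor_vanish C (star C \<U>\<^sub>1 \<T>) \<V>\<^sub>2"
  using mor_vanish_star_right[OF sub_obj(1) mor_heart(1) mor_12]
    mor_vanish_star_left[OF sub_obj(4) mor_12 mor_heart(2)] by auto

lemma torsion_pair_on_Psi: "torsion_pair_on C (obj C) (star C \<U>\<^sub>1 \<T>) (star C \<F> \<V>\<^sub>2)"
proof -
  have "star C \<U>\<^sub>1 (star C \<H> \<V>\<^sub>2) \<subseteq> star C \<U>\<^sub>1 (star C (star C \<T> \<F>) \<V>\<^sub>2)"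
    by (intro star_mono torsion_pair_onD(3)[OF tf] order.refl)
  then have cover: "obj C \<subseteq> star C (star C \<U>\<^sub>1 \<T>) (star C \<F> \<V>\<^sub>2)"
    using obj_subset_star_heart star_assoc by auto
  have van: "mor_vanish C (star C \<U>\<^sub>1 \<T>) (star C \<F> \<V>\<^sub>2)"
    using mor_vanish_star_right[OF star_subset_obj _ mor_Psi(2)]
      mor_vanish_star_left[OF heart_sub(4) mor_heart(1) torsion_pair_on_vanish[OF tf]] by blast
  have "X \<in> star C \<U>\<^sub>1 \<T>" if "X \<in> obj C" "mor_vanish C {X} (star C \<F> \<V>\<^sub>2)" for X
    using in_Psi_left mor_vanish_mono[OF that(2)] subset_Psi that(1) by auto
  moreover have "Y \<in> star C \<F> \<V>\<^sub>2" if "Y \<in> obj C" "mor_vanish C (star C \<U>\<^sub>1 \<T>) {Y}" for Y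
    using in_Psi_right mor_vanish_mono[OF that(2)] subset_Psi that(1) by auto
  ultimately show ?thesis
    using torsion_pair_on_orthogonalI[OF star_subset_obj star_subset_obj van cover] by blast
qed

text \<open>
  The pair \<open>(\<T>, \<F>)\<close> is contained in its image under \<open>\<Phi> \<circ> \<Psi>\<close>, and both are torsion pairs in the heart.
\<close>

lemma Phi_Psi: "star C \<U>\<^sub>1 \<T> \<inter> \<V>\<^sub>1 = \<T>" "star C \<F> \<V>\<^sub>2 \<inter> \<U>\<^sub>2 = \<F>"
proof -
  have t: "torsion_pair_on C \<H> (star C \<U>\<^sub>1 \<T> \<inter> \<V>\<^sub>1) (star C \<F> \<V>\<^sub>2 \<inter> \<U>\<^sub>2)"
    by (rule torsion_pair_on_Phi[OF torsion_pair_on_Psi mor_Psi(1) neg_Psi(1) mor_Psi(2) neg_Psi(2)])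
  have "\<T> \<subseteq> star C \<U>\<^sub>1 \<T> \<inter> \<V>\<^sub>1" "\<F> \<subseteq> star C \<F> \<V>\<^sub>2 \<inter> \<U>\<^sub>2"
    using subset_Psi(2,3) heart_sub(1,2) by blast+
  note eq = torsion_pair_on_unique[OF tf t this]
  show "star C \<U>\<^sub>1 \<T> \<inter> \<V>\<^sub>1 = \<T>" by (rule eq(1)[symmetric])
  show "star C \<F> \<V>\<^sub>2 \<inter> \<U>\<^sub>2 = \<F>" by (rule eq(2)[symmetric])
qed

end

text \<open>
  Here the containment goes the other way, since perpendicular classes are closed under extensions.
\<close>

lemma Psi_Phi:
  assumes t: "torsion_pair_on C (obj C) \<U> \<V>"
    and l: "mor_vanish C \<U>\<^sub>1 \<V>" "neg_vanish C \<U>\<^sub>1 \<V>"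
    and r: "mor_vanish C \<U> \<V>\<^sub>2" "neg_vanish C \<U> \<V>\<^sub>2"
  shows "star C \<U>\<^sub>1 (\<U> \<inter> \<V>\<^sub>1) = \<U>" "star C (\<V> \<inter> \<U>\<^sub>2) \<V>\<^sub>2 = \<V>"
proof -
  have t': "torsion_pair_on C (obj C) (star C \<U>\<^sub>1 (\<U> \<inter> \<V>\<^sub>1)) (star C (\<V> \<inter> \<U>\<^sub>2) \<V>\<^sub>2)"
    using torsion_pair_on_Psi[OF torsion_pair_on_Phi[OF t l r]
        neg_vanish_mono[OF r(2) Int_lower1 order.refl] neg_vanish_mono[OF l(2) order.refl Int_lower1]] .
  note van = torsion_pair_on_vanish[OF t]
  have o: "\<U> \<subseteq> obj C" "\<V> \<subseteq> obj C" using torsion_pair_onD(4,5)[OF t] by auto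
  have "mor_vanish C (star C \<U>\<^sub>1 (\<U> \<inter> \<V>\<^sub>1)) \<V>" "mor_vanish C \<U> (star C (\<V> \<inter> \<U>\<^sub>2) \<V>\<^sub>2)"
    using mor_vanish_star_left[OF o(2) l(1) mor_vanish_mono[OF van Int_lower1 order.refl]]
      mor_vanish_star_right[OF o(1) mor_vanish_mono[OF van order.refl Int_lower1] r(1)] .
  then have "star C \<U>\<^sub>1 (\<U> \<inter> \<V>\<^sub>1) \<subseteq> \<U>" "star C (\<V> \<inter> \<U>\<^sub>2) \<V>\<^sub>2 \<subseteq> \<V>"
    using torsion_pair_on_greatest[OF t star_subset_obj] by simp_all
  from torsion_pair_on_unique[OF t' t this]
  show "star C \<U>\<^sub>1 (\<U> \<inter> \<V>\<^sub>1) = \<U>" "star C (\<V> \<inter> \<U>\<^sub>2) \<V>\<^sub>2 = \<V>" .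
qed

lemma neg_vanish_star_star:
  assumes "\<T> \<subseteq> obj C" "\<F> \<subseteq> obj C" "neg_vanish C \<T> \<F>" "neg_vanish C \<T> \<V>\<^sub>2" "neg_vanish C \<U>\<^sub>1 \<F>"
  shows "neg_vanish C (star C \<U>\<^sub>1 \<T>) (star C \<F> \<V>\<^sub>2)"
  by (intro neg_vanish_star_left neg_vanish_star_right star_subset_obj sub_obj neg_12 assms)

lemma mor_vanish_star_star:
  assumes "\<T> \<subseteq> obj C" "\<F> \<subseteq> obj C" "mor_vanish C \<T> \<F>" "mor_vanish C \<T> \<V>\<^sub>2" "mor_vanish C \<U>\<^sub>1 \<F>"
  shows "mor_vanish C (star C \<U>\<^sub>1 \<T>) (star C \<F> \<V>\<^sub>2)"
  by (intro mor_vanish_star_left mor_vanish_star_right star_subset_obj sub_obj mor_12 assms)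

abbreviation in_interval :: "'o set \<Rightarrow> 'o set \<Rightarrow> bool" where
  "in_interval \<U> \<V> \<equiv> torsion_pair_on C (obj C) \<U> \<V> \<and>
     mor_vanish C \<U>\<^sub>1 \<V> \<and> neg_vanish C \<U>\<^sub>1 \<V> \<and> mor_vanish C \<U> \<V>\<^sub>2 \<and> neg_vanish C \<U> \<V>\<^sub>2"

abbreviation in_heart :: "'o set \<Rightarrow> 'o set \<Rightarrow> bool" where
  "in_heart \<T> \<F> \<equiv> torsion_pair_on C \<H> \<T> \<F> \<and> neg_vanish C \<T> \<V>\<^sub>2 \<and> neg_vanish C \<U>\<^sub>1 \<F>"

lemma in_heart_Phi: "in_interval \<U> \<V> \<Longrightarrow> in_heart (\<U> \<inter> \<V>\<^sub>1) (\<V> \<inter> \<U>\<^sub>2)"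
  using torsion_pair_on_Phi[of \<U> \<V>] neg_vanish_mono[of \<U>\<^sub>1 \<V> \<U>\<^sub>1 "\<V> \<inter> \<U>\<^sub>2"]
    neg_vanish_mono[of \<U> \<V>\<^sub>2 "\<U> \<inter> \<V>\<^sub>1" \<V>\<^sub>2] by simp

lemma in_interval_Psi: "in_heart \<T> \<F> \<Longrightarrow> in_interval (star C \<U>\<^sub>1 \<T>) (star C \<F> \<V>\<^sub>2)"
  using torsion_pair_on_Psi[of \<T> \<F>] mor_Psi[of \<T> \<F>] neg_Psi[of \<T> \<F>] by simp

text \<open>
  The two components come from different pairs so as to cover both the order on the images (\<open>\<T>\<close> from the
  smaller, \<open>\<F>\<close> from the larger pair) and, with equal pairs, the \<open>s\<close>-torsion condition.
\<close>

lemma Psi_vanish: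
  assumes "in_heart \<T> \<F>'" "in_heart \<T>' \<F>"
  shows "mor_vanish C \<T> \<F> \<Longrightarrow> mor_vanish C (star C \<U>\<^sub>1 \<T>) (star C \<F> \<V>\<^sub>2)"
    and "neg_vanish C \<T> \<F> \<Longrightarrow> neg_vanish C (star C \<U>\<^sub>1 \<T>) (star C \<F> \<V>\<^sub>2)"
  using assms mor_vanish_star_star[of \<T> \<F>] neg_vanish_star_star[of \<T> \<F>]
    mor_heart(2)[of \<T> \<F>'] mor_heart(1)[of \<T>' \<F>] heart_sub(3)[of \<T> \<F>'] heart_sub(4)[of \<T>' \<F>]
  by simp_all

end

section \<open>The bijections\<close>

lemma inverse_order_bijectionsI:
  assumes "\<And>a. a \<in> A \<Longrightarrow> f a \<in> B" "\<And>b. b \<in> B \<Longrightarrow> g b \<in> A"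
    and "\<And>a. a \<in> A \<Longrightarrow> g (f a) = a" "\<And>b. b \<in> B \<Longrightarrow> f (g b) = b"
    and "\<And>a a'. a \<in> A \<Longrightarrow> a' \<in> A \<Longrightarrow> rA a a' \<Longrightarrow> rB (f a) (f a')"
    and "\<And>b b'. b \<in> B \<Longrightarrow> b' \<in> B \<Longrightarrow> rB b b' \<Longrightarrow> rA (g b) (g b')"
  shows "inverse_order_bijections f g A rA B rB"
  unfolding inverse_order_bijections_def
  using assms by (auto intro: bij_betw_byWitness[where f' = g] bij_betw_byWitness[where f' = f])

lemma inverse_order_bijections_subset:
  assumes "inverse_order_bijections f g A rA B rB" "A' \<subseteq> A" "B' \<subseteq> B"
    and "\<And>a. a \<in> A' \<Longrightarrow> f a \<in> B'" "\<And>b. b \<in> B' \<Longrightarrow> g b \<in> A'"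
  shows "inverse_order_bijections f g A' rA B' rB"
  using assms unfolding inverse_order_bijections_def
  by (intro inverse_order_bijectionsI[unfolded inverse_order_bijections_def]) blast+

theorem theorem1p1:
  fixes C :: "('o, 'm, 'e, 'n) neg_extri_category"
    and \<U>1 \<V>1 \<U>2 \<V>2 :: "'o set"
  assumes "neg_extriangulated_category C"
    and "torsion_pair C (\<U>1, \<V>1)"
    and "torsion_pair C (\<U>2, \<V>2)"
    and "tp_le C (\<U>1, \<V>1) (\<U>2, \<V>2)"
  shows
    "inverse_order_bijections
       (interval_Phi (\<U>1, \<V>1) (\<U>2, \<V>2)) (interval_Psi C (\<U>1, \<V>1) (\<U>2, \<V>2))
       {t. torsion_pair C t \<and> tp_le C (\<U>1, \<V>1) t \<and> tp_le C t (\<U>2, \<V>2)}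
       (tp_le C)
       {(\<T>, \<F>). torsion_pair (restrict_category C (heart (\<U>1, \<V>1) (\<U>2, \<V>2))) (\<T>, \<F>) \<and>
                neg_vanish C \<T> \<V>2 \<and> neg_vanish C \<U>1 \<F>}
       (tp_le (restrict_category C (heart (\<U>1, \<V>1) (\<U>2, \<V>2))))
     \<and>
     inverse_order_bijections
       (interval_Phi (\<U>1, \<V>1) (\<U>2, \<V>2)) (interval_Psi C (\<U>1, \<V>1) (\<U>2, \<V>2))
       {t. s_torsion_pair C t \<and> tp_le C (\<U>1, \<V>1) t \<and> tp_le C t (\<U>2, \<V>2)}
       (tp_le C)
       {(\<T>, \<F>). s_torsion_pair (restrict_category C (heart (\<U>1, \<V>1) (\<U>2, \<V>2))) (\<T>, \<F>) \<and>
                neg_vanish C \<T> \<V>2 \<and> neg_vanish C \<U>1 \<F>}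
       (tp_le (restrict_category C (heart (\<U>1, \<V>1) (\<U>2, \<V>2))))"
    (is "inverse_order_bijections ?f ?g ?A _ ?B _ \<and> inverse_order_bijections _ _ ?As _ ?Bs _")
proof -
  interpret neg_extriangulated C
    using assms(1) by (rule neg_extriangulated.intro)
  interpret torsion_interval C \<U>1 \<V>1 \<U>2 \<V>2
    using assms(2-4) by unfold_locales (simp_all add: torsion_pair_iff del: torsion_pair.simps)
  have A: "(\<U>, \<V>) \<in> ?A \<longleftrightarrow> in_interval \<U> \<V>" for \<U> \<V>
    by (auto simp: torsion_pair_iff simp del: torsion_pair.simps)
  have B: "(\<T>, \<F>) \<in> ?B \<longleftrightarrow> in_heart \<T> \<F>" for \<T> \<F>
    using torsion_pair_restrict_iff[OF sub_obj(5)] by (simp del: torsion_pair.simps)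
  have bij: "inverse_order_bijections ?f ?g ?A (tp_le C) ?B (tp_le C)"
  proof (rule inverse_order_bijectionsI)
    fix t assume t: "t \<in> ?A"
    obtain \<U> \<V> where UV: "t = (\<U>, \<V>)" by (cases t)
    show "?f t \<in> ?B" using t unfolding UV A interval_Phi.simps B by (rule in_heart_Phi)
    show "?g (?f t) = t"
      using t Psi_Phi unfolding UV A interval_Phi.simps interval_Psi.simps prod.inject by blast
    fix t' assume "t' \<in> ?A" "tp_le C t t'"
    then show "tp_le C (?f t) (?f t')"
      unfolding UV by (cases t') (simp add: mor_vanish_def neg_vanish_def)
  next
    fix t assume t: "t \<in> ?B"
    obtain \<T> \<F> where TF: "t = (\<T>, \<F>)" by (cases t)
    show "?g t \<in> ?A" using t unfolding TF B interval_Psi.simps A by (rule in_interval_Psi)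
    show "?f (?g t) = t"
      using t Phi_Psi unfolding TF B interval_Phi.simps interval_Psi.simps prod.inject by blast
    fix t' assume t': "t' \<in> ?B" "tp_le C t t'"
    obtain \<T>' \<F>' where TF': "t' = (\<T>', \<F>')" by (cases t')
    show "tp_le C (?g t) (?g t')"
      using t t' Psi_vanish unfolding TF TF' B interval_Psi.simps tp_le.simps by blast
  qed
  \<comment> \<open>The \<open>s\<close>-torsion pairs form subsets that both maps preserve.\<close>
  moreover have "inverse_order_bijections ?f ?g ?As (tp_le C) ?Bs (tp_le C)"
  proof (rule inverse_order_bijections_subset[OF bij])
    have As: "(\<U>, \<V>) \<in> ?As \<longleftrightarrow> (\<U>, \<V>) \<in> ?A \<and> neg_vanish C \<U> \<V>" for \<U> \<V>
      by (auto simp del: torsion_pair.simps)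
    have Bs: "(\<T>, \<F>) \<in> ?Bs \<longleftrightarrow> (\<T>, \<F>) \<in> ?B \<and> neg_vanish C \<T> \<F>" for \<T> \<F>
      by (auto simp del: torsion_pair.simps)
    show "?As \<subseteq> ?A" by (rule subrelI) (use As in blast)
    show "?Bs \<subseteq> ?B" by (rule subrelI) (use Bs in blast)
    fix t :: "'o set \<times> 'o set"
    obtain \<X> \<Y> where XY: "t = (\<X>, \<Y>)" by (cases t)
    show "?f t \<in> ?Bs" if "t \<in> ?As"
    proof -
      have "(\<X>, \<Y>) \<in> ?A" "neg_vanish C \<X> \<Y>" using that XY As by blast+
      then show ?thesis
        using in_heart_Phi neg_vanish_mono unfolding XY interval_Phi.simps Bs A B by blast
    qed
    show "?g t \<in> ?As" if "t \<in> ?Bs"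
    proof -
      have "(\<X>, \<Y>) \<in> ?B" "neg_vanish C \<X> \<Y>" using that XY Bs by blast+
      then show ?thesis
        using in_interval_Psi Psi_vanish unfolding XY interval_Psi.simps As A B by blast
    qed
  qed
  ultimately show ?thesis by simp
qed

end
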